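(* Let $n=4k$ with $k\equiv 3\pmod 4$, and let $a\in\mathbb{F}_{3^4}\subseteq\mathbb{F}_{3^n}$ satisfy $a^4+a-1=0$. Then the function $f:\mathbb{F}_{3^n}\to\mathbb{F}_3$, $f(x)=\operatorname{Tr}_n\big(a\,x^{2(3^k+1)}+a^{-1}x^{(3^k+1)^2}\big)$, is a regular bent function of algebraic degree four belonging to the completed Maiorana–McFarland class.
   Context: $\operatorname{Tr}_n(x)=\sum_{i=0}^{n-1}x^{3^i}$ is the absolute trace $\mathbb{F}_{3^n}\to\mathbb{F}_3$. With $\omega=e^{2\pi i/3}$, $S_f(b)=\sum_{x\in\mathbb{F}_{3^n}}\omega^{f(x)-\operatorname{Tr}_n(bx)}$; $f$ is bent if $|S_f(b)|^2=3^n$ for all $b$, and regular bent if for all $b$, $3^{-n/2}S_f(b)=\omega^{f^*(b)}$ for some $f^*(b)\in\mathbb{F}_3$. Algebraic degree of $\operatorname{Tr}_n(\sum_d a_dx^d)$ means the maximal sum of ternary digits of an exponent $d$ occurring (in reduced form). Two functions $\mathbb{F}_3^n\to\mathbb{F}_3$ are EA-equivalent if $g=a\,(f\circ L)+l$ with $L$ an affine permutation, $l$ affine, $a\in\mathbb{F}_3^*$; the completed class of a class is the smallest union of EA-equivalence classes containing it. The Maiorana–McFarland class consists of functions $f(x,y)=x\cdot\pi(y)+g(y)$ on $\mathbb{F}_3^m\times\mathbb{F}_3^m$ ($n=2m$) with $\pi$ a permutation and $g$ arbitrary, functions on $\mathbb{F}_{3^n}$ being identified with such via an $\mathbb{F}_3$-linear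 isomorphism. *)

theory Defs
  imports Complex_Main "HOL-Library.FuncSet" "HOL-Library.Cardinality" "HOL-Computational_Algebra.Polynomial"
begin

text \<open>
  The field with \<open>3 ^ n\<close> elements is a type \<open>'a :: {field, finite}\<close> with \<open>CARD('a) = 3 ^ n\<close>.
  The field with three elements is its prime subfield, so functions into it are functions
  \<open>'a \<Rightarrow> 'a\<close> with values in \<open>F3\<close>.  The definitions below are meant for characteristic 3.
\<close>

definition F3 :: "'a::field set" where
  "F3 = {0, 1, 2}"

definition is_subfield :: "'a::field set \<Rightarrow> bool" where
  "is_subfield K \<longleftrightarrow> 0 \<in> K \<and> 1 \<in> K \<and>
     (\<forall>x\<in>K. \<forall>y\<in>K. x - y \<in> K) \<and> (\<forall>x\<in>K. \<forall>y\<in>K. x * y \<in> K) \<and> (\<forall>x\<in>K. inverse x \<in> K)"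

definition Tr :: "nat \<Rightarrow> 'a::field \<Rightarrow> 'a" where
  "Tr n x = (\<Sum>i<n. x ^ (3 ^ i))"

definition omega :: complex where
  "omega = exp (2 * of_real pi * \<i> / 3)"

text \<open>\<open>omega_pow u\<close> is \<open>omega\<close> raised to \<open>u\<close>, for \<open>u\<close> in the prime field; the exponent is the
  representative of \<open>u\<close> in \<open>{0, 1, 2}\<close>.\<close>

definition omega_pow :: "'a::field \<Rightarrow> complex" where
  "omega_pow u = omega ^ (THE j. j < 3 \<and> of_nat j = u)"

definition walsh :: "nat \<Rightarrow> ('a::{field,finite} \<Rightarrow> 'a) \<Rightarrow> 'a \<Rightarrow> complex" where
  "walsh n f b = (\<Sum>x\<in>UNIV. omega_pow (f x - Tr n (b * x)))"

definition bent :: "nat \<Rightarrow> ('a::{field,finite} \<Rightarrow> 'a) \<Rightarrow> bool" where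
  "bent n f \<longleftrightarrow> f \<in> UNIV \<rightarrow> F3 \<and> (\<forall>b. (cmod (walsh n f b))\<^sup>2 = 3 ^ n)"

definition regular_bent :: "nat \<Rightarrow> ('a::{field,finite} \<Rightarrow> 'a) \<Rightarrow> bool" where
  "regular_bent n f \<longleftrightarrow> bent n f \<and>
     (\<exists>fs :: 'a \<Rightarrow> 'a. fs \<in> UNIV \<rightarrow> F3 \<and>
       (\<forall>b. of_real (3 powr (- real n / 2)) * walsh n f b = omega_pow (fs b)))"

text \<open>The reduced form of a function on a field with \<open>q\<close> elements: the unique polynomial of
  degree less than \<open>q\<close> inducing it.\<close>

definition is_reduced_form :: "('a::{field,finite} \<Rightarrow> 'a) \<Rightarrow> 'a poly \<Rightarrow> bool" where
  "is_reduced_form f p \<longleftrightarrow> degree p < CARD('a) \<and> (\<forall>x. poly p x = f x)"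

lemma ex1_reduced_form:
  fixes f :: "'a::{field,finite} \<Rightarrow> 'a"
  shows "\<exists>!p. is_reduced_form f p"
proof (rule ex_ex1I)
  define L :: "'a \<Rightarrow> 'a poly"
    where "L c = (\<Prod>b\<in>UNIV - {c}. smult (inverse (c - b)) [:- b, 1:])" for c
  define p where "p = (\<Sum>c\<in>UNIV. smult (f c) (L c))"
  have L: "poly (L c) x = (if x = c then 1 else 0)" for c x
  proof -
    have "poly (L c) x = (\<Prod>b\<in>UNIV - {c}. inverse (c - b) * (x - b))"
      by (simp add: L_def poly_prod algebra_simps)
    then show ?thesis by (auto intro!: prod.neutral)
  qed
  have "poly p x = (\<Sum>c\<in>UNIV. if x = c then f c else 0)" for x
    unfolding p_def poly_sum by (intro sum.cong) (auto simp: L)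
  then have 1: "poly p x = f x" for x by simp
  have "degree (L c) \<le> CARD('a) - 1" for c
  proof -
    have "degree (L c) \<le> (\<Sum>b\<in>UNIV - {c}. degree (smult (inverse (c - b)) [:- b, 1:]))"
      unfolding L_def by (rule order_trans[OF degree_prod_sum_le]) (simp_all only: finite o_def order_refl)
    also have "\<dots> \<le> (\<Sum>b\<in>UNIV - {c}. 1)" by (rule sum_mono) simp
    also have "\<dots> = CARD('a) - 1" by (simp add: card_Diff_singleton)
    finally show ?thesis .
  qed
  then have "degree (smult (f c) (L c)) \<le> CARD('a) - 1" for c
    using degree_smult_le order_trans by blast
  then have "degree p \<le> CARD('a) - 1"
    unfolding p_def by (intro degree_sum_le) simp_all
  moreover have "CARD('a) > 0" by simp
  ultimately have "degree p < CARD('a)" by linarith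
  with 1 show "\<exists>p. is_reduced_form f p"
    unfolding is_reduced_form_def by blast
next
  fix p q assume p: "is_reduced_form f p" and q: "is_reduced_form f q"
  show "p = q"
  proof (rule ccontr)
    assume "p \<noteq> q"
    then have nz: "p - q \<noteq> 0" by simp
    have "{x. poly (p - q) x = 0} = UNIV"
      using p q by (auto simp: is_reduced_form_def)
    then have "CARD('a) \<le> degree (p - q)" using card_poly_roots_bound[OF nz] by simp
    moreover have "degree (p - q) < CARD('a)"
      using p q unfolding is_reduced_form_def by (blast intro: degree_diff_less)
    ultimately show False by simp
  qed
qed

definition reduced_form :: "('a::{field,finite} \<Rightarrow> 'a) \<Rightarrow> 'a poly" where
  "reduced_form f = (THE p. is_reduced_form f p)"

text \<open>The sum of the ternary digits of \<open>d\<close>; the digits at positions above \<open>d\<close> vanish.\<close>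

definition ternary_weight :: "nat \<Rightarrow> nat" where
  "ternary_weight d = (\<Sum>i\<le>d. d div 3 ^ i mod 3)"

text \<open>A trace \<open>Tr n (\<Sum>d. a d * x ^ d)\<close> is expanded here: the reduced form contains each reduced
  exponent \<open>d\<close> together with the exponents \<open>3 ^ i * d\<close> reduced modulo \<open>3 ^ n - 1\<close>, which have
  the same ternary weight.  The inserted \<open>0\<close> only matters for the zero function.\<close>

definition algebraic_degree :: "('a::{field,finite} \<Rightarrow> 'a) \<Rightarrow> nat" where
  "algebraic_degree f = Max (insert 0 (ternary_weight ` {d. coeff (reduced_form f) d \<noteq> 0}))"

definition F3_linear :: "('a::field \<Rightarrow> 'a) \<Rightarrow> bool" where
  "F3_linear h \<longleftrightarrow> (\<forall>x y. h (x + y) = h x + h y) \<and> (\<forall>c\<in>F3. \<forall>x. h (c * x) = c * h x)"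

definition F3_affine :: "('a::field \<Rightarrow> 'a) \<Rightarrow> bool" where
  "F3_affine h \<longleftrightarrow> (\<exists>h0 c. F3_linear h0 \<and> (\<forall>x. h x = h0 x + c))"

definition F3_functions :: "('a::field \<Rightarrow> 'a) set" where
  "F3_functions = UNIV \<rightarrow> F3"

definition EA_rel :: "(('a::field \<Rightarrow> 'a) \<times> ('a \<Rightarrow> 'a)) set" where
  "EA_rel = {(f, g). f \<in> F3_functions \<and> g \<in> F3_functions \<and>
     (\<exists>a L l. a \<in> F3 - {0} \<and> F3_affine L \<and> bij L \<and> F3_affine l \<and> l \<in> F3_functions \<and>
       (\<forall>x. g x = a * f (L x) + l x))}"

text \<open>The smallest union of EA-classes containing \<open>C\<close>, for \<open>C \<subseteq> F3_functions\<close>.\<close>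

definition completed_class :: "('a::field \<Rightarrow> 'a) set \<Rightarrow> ('a \<Rightarrow> 'a) set" where
  "completed_class C = \<Inter> {\<Union>\<D> | \<D>. \<D> \<subseteq> F3_functions // EA_rel \<and> C \<subseteq> \<Union>\<D>}"

text \<open>Vectors of length \<open>m\<close> over the prime field are functions on \<open>nat\<close> vanishing from \<open>m\<close> on.\<close>

definition F3_vecs :: "nat \<Rightarrow> (nat \<Rightarrow> 'a::field) set" where
  "F3_vecs m = {v. (\<forall>i<m. v i \<in> F3) \<and> (\<forall>i\<ge>m. v i = 0)}"

definition dot :: "nat \<Rightarrow> (nat \<Rightarrow> 'a::field) \<Rightarrow> (nat \<Rightarrow> 'a) \<Rightarrow> 'a" where
  "dot m u v = (\<Sum>i<m. u i * v i)"

text \<open>\<open>\<lambda>z. (X z, Y z)\<close> is the linear isomorphism identifying the field with pairs of vectors.\<close>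

definition lin_iso :: "nat \<Rightarrow> ('a::field \<Rightarrow> nat \<Rightarrow> 'a) \<Rightarrow> ('a \<Rightarrow> nat \<Rightarrow> 'a) \<Rightarrow> bool" where
  "lin_iso m X Y \<longleftrightarrow> bij_betw (\<lambda>z. (X z, Y z)) UNIV (F3_vecs m \<times> F3_vecs m) \<and>
     (\<forall>i. F3_linear (\<lambda>z. X z i) \<and> F3_linear (\<lambda>z. Y z i))"

definition MM_class :: "nat \<Rightarrow> ('a::field \<Rightarrow> 'a) set" where
  "MM_class n = {f. \<exists>m X Y \<pi> g. n = 2 * m \<and> lin_iso m X Y \<and>
     bij_betw \<pi> (F3_vecs m) (F3_vecs m) \<and> g \<in> F3_vecs m \<rightarrow> F3 \<and>
     (\<forall>z. f z = dot m (X z) (\<pi> (Y z)) + g (Y z))}"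

end

theory Submission
  imports Defs "HOL-Computational_Algebra.Primes"
begin

text \<open>
  Write \<open>q = 3 ^ k\<close> and let \<open>L\<close> be the subfield with \<open>q\<close> elements. Since \<open>k\<close> is coprime to 4, the powers
  \<open>1, a, a\<^sup>2, a\<^sup>3\<close> form a basis over \<open>L\<close>, and \<open>a ^ q = a ^ 27\<close>. In such coordinates \<open>f\<close> is the trace of a
  quartic form over \<open>L\<close> whose coefficients do not depend on \<open>k\<close>. Writing
  \<open>z = x1 * (a + a\<^sup>2) + x2 * (1 + a\<^sup>2) + y1 * a\<^sup>3 + y2 * a\<^sup>2\<close>, the form becomes
  \<open>x1 * c1 y1 y2 + x2 * c2 y1 y2 - y1\<^sup>4 - y2\<^sup>4\<close>, with \<open>c1\<close> and \<open>c2\<close> cubic. As \<open>k\<close> is odd, \<open>-1\<close> is not a square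
  in \<open>L\<close>, and this makes \<open>(c1, c2)\<close> a permutation of \<open>L \<times> L\<close>. So \<open>f\<close> itself lies in the Maiorana--McFarland
  class, and regularity follows from the usual character sum argument.
\<close>

section \<open>Fields of characteristic three\<close>

text \<open>Multiplication by a nonzero \<open>x\<close> permutes the nonzero elements; comparing
  their products gives \<open>x ^ (CARD('a) - 1) = 1\<close>.\<close>

lemma power_card_eq_self: "(x :: 'a::{field,finite}) ^ CARD('a) = x"
proof (cases "x = 0")
  case False
  let ?U = "UNIV - {0 :: 'a}"
  have "bij_betw ((*) x) ?U ?U"
    by (rule bij_betw_byWitness[of _ "\<lambda>y. y / x"]) (use False in auto)
  then have "(\<Prod>y\<in>?U. x * y) = \<Prod>?U"
    by (rule prod.reindex_bij_betw)
  moreover have "(\<Prod>y\<in>?U. x * y) = x ^ (CARD('a) - 1) * \<Prod>?U"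
    by (simp add: prod.distrib card_Diff_singleton)
  ultimately have "x ^ (CARD('a) - 1) = 1"
    by simp
  then show ?thesis
    by (metis Suc_diff_1 mult.right_neutral power_Suc zero_less_card_finite)
qed simp

text \<open>Translation by 1 leaves the sum of all elements unchanged, so \<open>CARD('a)\<close>, a
  power of 3, vanishes in the field.\<close>

lemma three_eq_zero:
  assumes "CARD('a::{field,finite}) = 3 ^ n"
  shows "(3 :: 'a) = 0"
proof -
  have "(\<Sum>x\<in>UNIV. x + (1 :: 'a)) = (\<Sum>x\<in>UNIV. x)"
    by (rule sum.reindex_bij_witness[of _ "\<lambda>x. x - 1" "\<lambda>x. x + 1"]) auto
  then have "of_nat (CARD('a)) = (0 :: 'a)"
    by (simp add: sum.distrib)
  then show ?thesis
    unfolding assms by simp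
qed

lemma char_three_CHAR:
  assumes "(3 :: 'a::field) = 0"
  shows "CHAR('a) = 3"
proof -
  have "CHAR('a) dvd 3"
    using assms of_nat_eq_0_iff_char_dvd[where 'a = 'a, of 3] by simp
  moreover have "prime (3 :: nat)"
    by simp
  ultimately show ?thesis
    using CHAR_not_1'[where 'a = 'a] by (metis One_nat_def prime_nat_iff)
qed

lemma frob_add:
  assumes "(3 :: 'a::field) = 0"
  shows "(x + y :: 'a) ^ 3 ^ j = x ^ 3 ^ j + y ^ 3 ^ j"
  using char_three_CHAR[OF assms] by (intro freshmans_dream') auto

lemma frob_minus: "(- x :: 'a::field) ^ 3 ^ j = - (x ^ 3 ^ j)"
  by (rule power_minus_odd) simp

lemma frob_diff:
  assumes "(3 :: 'a::field) = 0"
  shows "(x - y :: 'a) ^ 3 ^ j = x ^ 3 ^ j - y ^ 3 ^ j"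
  using frob_add[OF assms, of x "- y" j] by (simp add: frob_minus)

text \<open>Modulo 3, \<open>x ^ 3 - x\<close> factors as \<open>x * (x - 1) * (x - 2)\<close>.
  Seeing \<open>F3\<close> as the fixed points of cubing reduces its closure properties to the
  Frobenius rules.\<close>

lemma F3_iff:
  assumes "(3 :: 'a::field) = 0"
  shows "x \<in> F3 \<longleftrightarrow> x ^ 3 = (x :: 'a)"
proof -
  have "x ^ 3 - x = x * (x - 1) * (x - 2) + 3 * (x\<^sup>2 - x)"
    by algebra
  then have "x ^ 3 - x = x * (x - 1) * (x - 2)"
    using assms by simp
  moreover have "x ^ 3 = x \<longleftrightarrow> x ^ 3 - x = 0"
    by simp
  ultimately show ?thesis
    by (auto simp: F3_def simp del: right_minus_eq) simp_all
qed

section \<open>Arithmetic of the prime field and the trace\<close>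

context
  assumes three: "(3 :: 'a::field) = 0"
begin

lemma two_neq_zero: "(2 :: 'a) \<noteq> 0"
proof
  assume "(2 :: 'a) = 0"
  then have "(3 :: 'a) - 2 = 0"
    using three by simp
  then show False
    by simp
qed

lemma one_neq_two: "(2 :: 'a) \<noteq> 1"
proof
  assume "(2 :: 'a) = 1"
  then have "(2 :: 'a) - 1 = 0"
    by simp
  then show False
    by simp
qed

lemma F3_add: "x \<in> F3 \<Longrightarrow> y \<in> F3 \<Longrightarrow> x + y \<in> (F3 :: 'a set)"
  using frob_add[OF three, of x y 1] by (simp add: F3_iff[OF three])

lemma F3_diff: "x \<in> F3 \<Longrightarrow> y \<in> F3 \<Longrightarrow> x - y \<in> (F3 :: 'a set)"
  using frob_diff[OF three, of x y 1] by (simp add: F3_iff[OF three])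

lemma F3_mult: "x \<in> F3 \<Longrightarrow> y \<in> F3 \<Longrightarrow> x * y \<in> (F3 :: 'a set)"
  by (simp add: F3_iff[OF three] power_mult_distrib)

lemma F3_zero: "0 \<in> (F3 :: 'a set)" and F3_one: "1 \<in> (F3 :: 'a set)"
  by (auto simp: F3_def)

lemma F3_sum: "(\<And>i. i \<in> A \<Longrightarrow> h i \<in> F3) \<Longrightarrow> sum h A \<in> (F3 :: 'a set)"
  by (induction A rule: infinite_finite_induct) (auto simp: F3_zero intro: F3_add)

lemma F3_square:
  assumes "t \<in> F3" "t \<noteq> (0 :: 'a)"
  shows "t * t = 1"
proof -
  have "t * (t * t - 1) = t ^ 3 - t"
    by algebra
  also have "\<dots> = 0"
    using assms(1) unfolding F3_iff[OF three] by simp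
  finally have "t * (t * t - 1) = 0" .
  then show ?thesis
    using assms(2) by simp
qed

lemma card_F3: "card (F3 :: 'a set) = 3"
  using two_neq_zero one_neq_two by (auto simp: F3_def card_insert_if)

text \<open>The scalars are 0, 1 and \<open>1 + 1\<close>, so additivity suffices.\<close>

lemma F3_linearI:
  assumes "\<And>x y. h (x + y) = h x + h (y :: 'a)"
  shows "F3_linear h"
proof -
  have "h 0 = 0"
    using assms[of 0 0] by (metis add_0 add_cancel_right_right)
  moreover have "h (2 * x) = 2 * h x" for x
    unfolding mult_2 by (rule assms)
  ultimately have "h (c * x) = c * h x" if "c \<in> F3" for c x
    using that by (auto simp: F3_def)
  with assms show ?thesis
    by (simp add: F3_linear_def)
qed

lemma Tr_add: "Tr m (x + y :: 'a) = Tr m x + Tr m y"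
  by (simp add: Tr_def frob_add[OF three] sum.distrib)

text \<open>Cubing shifts the summands of the trace by one place and the last wraps around to the
  first. This serves both the whole field (\<open>m = n\<close>) and the subfield \<open>L\<close>
  (\<open>m = k\<close>).\<close>

lemma Tr_in_F3:
  assumes "x ^ 3 ^ m = (x :: 'a)"
  shows "Tr m x \<in> F3"
proof -
  have "Tr m x ^ 3 = (\<Sum>i<m. x ^ 3 ^ Suc i)"
    unfolding Tr_def
    by (subst freshmans_dream_sum) (auto simp: char_three_CHAR[OF three] power_mult[symmetric] mult.commute)
  moreover have "(\<Sum>i<m. x ^ 3 ^ Suc i) + x = (\<Sum>i<Suc m. x ^ 3 ^ i)"
    by (subst sum.lessThan_Suc_shift) simp
  moreover have "\<dots> = Tr m x + x"
    using assms by (simp add: Tr_def)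
  ultimately show ?thesis
    by (simp add: F3_iff[OF three])
qed

end

lemma Tr_plus: "Tr (i + j) x = Tr i x + Tr j (x ^ 3 ^ i)"
  by (induction j) (auto simp: Tr_def power_add power_mult[symmetric] algebra_simps)

subsection \<open>The complex cube root of unity\<close>

lemma omega_cube: "omega ^ 3 = 1"
proof -
  have "omega ^ 3 = exp (of_nat 3 * (2 * of_real pi * \<i> / 3))"
    unfolding omega_def by (rule exp_of_nat_mult[symmetric])
  then show ?thesis
    using exp_two_pi_i by (simp add: mult_ac)
qed

lemma omega_neq_1: "omega \<noteq> 1"
proof
  assume "omega = 1"
  then have "Im omega = 0"
    by simp
  moreover have "omega = cis (2 * pi / 3)"
    by (simp add: omega_def cis_conv_exp field_simps)
  ultimately have "sin (2 * pi / 3) = 0"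
    by (metis cis.simps(2))
  moreover have "sin (2 * pi / 3) > 0"
    by (rule sin_gt_zero) (use pi_gt_zero in auto)
  ultimately show False
    by simp
qed

lemma omega_square_neq_1: "omega ^ 2 \<noteq> 1"
  using omega_cube omega_neq_1 by (auto simp: power2_eq_square power3_eq_cube)

lemma norm_omega_pow: "cmod (omega_pow u) = 1"
  by (simp add: omega_pow_def norm_power omega_def)

context
  assumes three: "(3 :: 'a::field) = 0"
begin

lemma omega_pow_of_nat:
  assumes "j < 3"
  shows "omega_pow (of_nat j :: 'a) = omega ^ j"
proof -
  have "i = j" if "i < 3" "of_nat i = (of_nat j :: 'a)" for i
  proof -
    have "i = 0 \<or> i = 1 \<or> i = 2" "j = 0 \<or> j = 1 \<or> j = 2"
      using that assms by auto
    then show ?thesis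
      using that(2) two_neq_zero[OF three] one_neq_two[OF three] one_neq_two[OF three, symmetric] by auto
  qed
  then have "(THE i. i < 3 \<and> of_nat i = (of_nat j :: 'a)) = j"
    using assms by (intro the_equality) auto
  then show ?thesis
    by (simp add: omega_pow_def)
qed

lemma omega_pow_simps:
  "omega_pow (0 :: 'a) = 1" "omega_pow (1 :: 'a) = omega" "omega_pow (2 :: 'a) = omega\<^sup>2"
  using omega_pow_of_nat[of 0] omega_pow_of_nat[of 1] omega_pow_of_nat[of 2] by simp_all

lemma omega_pow_add:
  assumes "u \<in> F3" "v \<in> F3"
  shows "omega_pow (u + v :: 'a) = omega_pow u * omega_pow v"
proof -
  have "(1 :: 'a) + 2 = 0" "(2 :: 'a) + 1 = 0" "(2 :: 'a) + 2 = 1"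
    using three by (simp_all add: eq_iff_diff_eq_0[of 4])
  moreover have "omega * omega\<^sup>2 = 1" "omega\<^sup>2 * omega = 1" "omega\<^sup>2 * omega\<^sup>2 = omega"
    using omega_cube by (simp_all add: power2_eq_square power3_eq_cube mult.assoc)
  ultimately show ?thesis
    using assms by (auto simp: F3_def omega_pow_simps power2_eq_square[symmetric])
qed

lemma omega_pow_neq_1: "u \<in> F3 \<Longrightarrow> u \<noteq> (0 :: 'a) \<Longrightarrow> omega_pow u \<noteq> 1"
  using omega_neq_1 omega_square_neq_1 by (auto simp: F3_def omega_pow_simps)

subsection \<open>Coordinate vectors over the prime field\<close>

lemma F3_vecs_Suc: "bij_betw (\<lambda>(v, c). v(m := c)) (F3_vecs m \<times> F3) (F3_vecs (Suc m) :: (nat \<Rightarrow> 'a) set)"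
proof (rule bij_betw_byWitness[of _ "\<lambda>v. (v(m := 0), v m)"])
  show "(\<lambda>(v, c). v(m := c)) ` (F3_vecs m \<times> F3) \<subseteq> (F3_vecs (Suc m) :: (nat \<Rightarrow> 'a) set)"
    by (auto simp: F3_vecs_def less_Suc_eq)
  show "(\<lambda>v. (v(m := 0), v m)) ` F3_vecs (Suc m) \<subseteq> (F3_vecs m \<times> F3 :: ((nat \<Rightarrow> 'a) \<times> 'a) set)"
    by (auto simp: F3_vecs_def)
qed (auto simp: F3_vecs_def)

lemma card_F3_vecs: "card (F3_vecs m :: (nat \<Rightarrow> 'a) set) = 3 ^ m"
proof (induction m)
  case 0
  have "F3_vecs 0 = {\<lambda>_. 0 :: 'a}"
    by (auto simp: F3_vecs_def)
  then show ?case
    by simp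
next
  case (Suc m)
  then show ?case
    using bij_betw_same_card[OF F3_vecs_Suc[of m]] by (simp add: card_cartesian_product card_F3[OF three])
qed

lemma finite_F3_vecs: "finite (F3_vecs m :: (nat \<Rightarrow> 'a) set)"
  using card_F3_vecs by (simp add: card_ge_0_finite)

lemma F3_vecs_add: "u \<in> F3_vecs m \<Longrightarrow> v \<in> F3_vecs m \<Longrightarrow> (\<lambda>i. u i + v i :: 'a) \<in> F3_vecs m"
  by (auto simp: F3_vecs_def intro: F3_add[OF three])

lemma dot_in_F3: "u \<in> F3_vecs m \<Longrightarrow> v \<in> F3_vecs m \<Longrightarrow> dot m u v \<in> (F3 :: 'a set)"
  unfolding dot_def by (rule F3_sum[OF three]) (auto simp: F3_vecs_def intro: F3_mult[OF three])

section \<open>Bases of additive subgroups over the prime field\<close>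

lemma dot_in_subgroup:
  assumes "0 \<in> V" and add: "\<And>x y. x \<in> V \<Longrightarrow> y \<in> V \<Longrightarrow> x + y \<in> V"
    and c: "\<And>i. i < m \<Longrightarrow> c i \<in> F3" and e: "\<And>i. i < m \<Longrightarrow> e i \<in> V"
  shows "dot m c e \<in> (V :: 'a set)"
proof -
  have "c i * e i \<in> V" if "i < m" for i
    using c[OF that] e[OF that] add[of "e i" "e i"] assms(1) by (auto simp: F3_def mult_2[symmetric])
  then show ?thesis
    unfolding dot_def using assms(1) by (induction m) (auto intro: add)
qed

text \<open>Independence over \<open>F3\<close> is expressed as injectivity of the combination map.
  If two equal combinations differed by \<open>t\<close> at \<open>v\<close>, then \<open>v\<close>
  would be a combination of the old vectors, because a nonzero \<open>t\<close> in \<open>F3\<close>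
  is its own inverse; \<open>?w\<close> below is its coefficient vector.\<close>

lemma extend_independent:
  assumes inj: "inj_on (\<lambda>c. dot j c e) (F3_vecs j)" and v: "v \<notin> (\<lambda>c. dot j c e) ` F3_vecs j"
  shows "inj_on (\<lambda>c. dot (Suc j) c (e(j := v :: 'a))) (F3_vecs (Suc j))"
proof (rule inj_onI)
  fix c d :: "nat \<Rightarrow> 'a"
  assume c: "c \<in> F3_vecs (Suc j)" and d: "d \<in> F3_vecs (Suc j)"
    and "dot (Suc j) c (e(j := v)) = dot (Suc j) d (e(j := v))"
  then have eq: "dot j c e + c j * v = dot j d e + d j * v"
    by (simp add: dot_def)
  have "c j = d j"
  proof (rule ccontr)
    assume "c j \<noteq> d j"
    define t where "t = c j - d j"
    have t: "t \<in> F3" "t * t = 1"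
      using c d \<open>c j \<noteq> d j\<close> unfolding t_def
      by (auto simp: F3_vecs_def intro!: F3_diff[OF three] F3_square[OF three])
    let ?w = "\<lambda>i. if i < j then t * (d i - c i) else 0"
    have "?w \<in> F3_vecs j"
      using c d t by (auto simp: F3_vecs_def intro!: F3_diff[OF three] F3_mult[OF three])
    moreover have "dot j ?w e = t * (dot j d e - dot j c e)"
      by (simp add: dot_def sum_subtractf[symmetric] sum_distrib_left algebra_simps)
    moreover have "\<dots> = t * t * v"
      using eq unfolding t_def by algebra
    ultimately show False
      using v t by force
  qed
  moreover have "c(j := 0) = d(j := 0)"
  proof (rule inj_onD[OF inj])
    show "dot j (c(j := 0)) e = dot j (d(j := 0)) e"
      using eq \<open>c j = d j\<close> by (simp add: dot_def)
  qed (use c d in \<open>auto simp: F3_vecs_def\<close>)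
  ultimately show "c = d"
    by (metis fun_upd_triv fun_upd_upd)
qed

text \<open>A basis is chosen greedily: while \<open>j < m\<close>, the combinations of
  \<open>j\<close> vectors number only \<open>3 ^ j\<close> and miss some element of
  \<open>V\<close>. Closure under addition already gives closure under the scalar 2.\<close>

lemma subgroup_basis:
  assumes "0 \<in> V" and add: "\<And>x y. x \<in> V \<Longrightarrow> y \<in> V \<Longrightarrow> x + y \<in> V"
    and card: "card V = 3 ^ m"
  obtains e where "\<And>i. i < m \<Longrightarrow> e i \<in> V" "bij_betw (\<lambda>c. dot m c e) (F3_vecs m) (V :: 'a set)"
proof -
  have fin: "finite V"
    using card by (simp add: card_ge_0_finite)
  have sub: "(\<lambda>c. dot j c e) ` F3_vecs j \<subseteq> V" if "\<forall>i<j. e i \<in> V" for j e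
    using that by (auto simp: F3_vecs_def intro!: dot_in_subgroup assms)
  have "j \<le> m \<Longrightarrow> \<exists>e. (\<forall>i<j. e i \<in> V) \<and> inj_on (\<lambda>c. dot j c e) (F3_vecs j)" for j
  proof (induction j)
    case 0
    then show ?case
      by (auto simp: F3_vecs_def inj_on_def fun_eq_iff)
  next
    case (Suc j)
    then obtain e where e: "\<forall>i<j. e i \<in> V" "inj_on (\<lambda>c. dot j c e) (F3_vecs j)"
      by auto
    have "card ((\<lambda>c. dot j c e) ` F3_vecs j) < card V"
      using Suc.prems card by (simp add: card_image[OF e(2)] card_F3_vecs)
    then obtain v where v: "v \<in> V" "v \<notin> (\<lambda>c. dot j c e) ` F3_vecs j"
      using sub[OF e(1)] by (metis nless_le subsetI subset_antisym)
    show ?case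
      using extend_independent[OF e(2) v(2)] e(1) v(1)
      by (intro exI[of _ "e(j := v)"] conjI) (simp add: less_Suc_eq)
  qed
  then obtain e where e: "\<forall>i<m. e i \<in> V" "inj_on (\<lambda>c. dot m c e) (F3_vecs m)"
    by blast
  have "(\<lambda>c. dot m c e) ` F3_vecs m = V"
    using sub[OF e(1)] fin card by (intro card_subset_eq) (auto simp: card_image[OF e(2)] card_F3_vecs)
  then show ?thesis
    using that[of e] e by (simp add: bij_betw_def)
qed

end

section \<open>The Maiorana--McFarland class\<close>

lemma powr_neg_half: "(3 :: real) powr (- real (2 * m) / 2) = inverse (3 ^ m)"
proof -
  have "(3 :: real) powr (- real (2 * m) / 2) = 3 powr (- real m)"
    by simp
  also have "\<dots> = inverse (3 ^ m)"
    by (simp only: powr_minus) (simp add: powr_realpow)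
  finally show ?thesis .
qed

context
  assumes three: "(3 :: 'a::{field,finite}) = 0"
begin

lemma F3_linear_dot:
  assumes "F3_linear (h :: 'a \<Rightarrow> 'a)" "\<And>i. i < m \<Longrightarrow> c i \<in> F3"
  shows "h (dot m c e) = dot m c (\<lambda>i. h (e i))"
proof -
  have "h 0 = 0"
    using assms(1) F3_zero[OF three] unfolding F3_linear_def by (metis mult_zero_left)
  then have "h (\<Sum>i<m. c i * e i) = (\<Sum>i<m. h (c i * e i))"
    using assms(1) unfolding F3_linear_def by (induction m) simp_all
  also have "\<dots> = (\<Sum>i<m. c i * h (e i))"
    using assms unfolding F3_linear_def by (intro sum.cong) auto
  finally show ?thesis
    by (simp add: dot_def)
qed

lemma F3_linear_diff:
  assumes "F3_linear (h :: 'a \<Rightarrow> 'a)"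
  shows "h (x - y) = h x - h y"
proof -
  have "h (x - y + y) = h (x - y) + h y"
    using assms unfolding F3_linear_def by blast
  then show ?thesis
    by simp
qed

lemma dot_unit: "i < m \<Longrightarrow> dot m (\<lambda>j. if j = i then 1 else 0) v = (v i :: 'a)"
  by (simp add: dot_def if_distrib[of "\<lambda>x. x * _"] cong: if_cong)

text \<open>On a fibre of \<open>Y\<close>, translating by \<open>d\<close> with \<open>Y d = 0\<close> multiplies the summand by
  \<open>omega_pow (\<chi> d)\<close> for an additive \<open>\<chi>\<close>. So a fibre contributes only if its \<open>\<chi>\<close> vanishes, and
  because \<open>\<pi>\<close> is a permutation this happens for exactly one fibre.\<close>

lemma MM_class_walsh:
  assumes card: "CARD('a) = 3 ^ n" and "n = 2 * m" and iso: "lin_iso m X Y"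
    and pi: "bij_betw \<pi> (F3_vecs m) (F3_vecs m)" and g: "g \<in> F3_vecs m \<rightarrow> F3"
    and f: "\<And>z. f z = dot m (X z) (\<pi> (Y z)) + (g (Y z) :: 'a)"
  shows "\<exists>z. walsh n f b = 3 ^ m * omega_pow (f z - Tr n (b * z))"
proof -
  have Xadd: "X (x + y) i = X x i + X y i" and Yadd: "Y (x + y) i = Y x i + Y y i" for x y i
    using iso unfolding lin_iso_def F3_linear_def by auto
  have Xdiff: "X (x - y) i = X x i - X y i" and Ydiff: "Y (x - y) i = Y x i - Y y i" for x y i
    using iso F3_linear_diff unfolding lin_iso_def by blast+
  have XY: "bij_betw (\<lambda>z. (X z, Y z)) UNIV (F3_vecs m \<times> F3_vecs m)"
    using iso unfolding lin_iso_def by blast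
  have Xin: "X z \<in> F3_vecs m" and Yin: "Y z \<in> F3_vecs m" for z
    using bij_betwE[OF XY] by auto
  have inj: "x = y" if "X x = X y" "Y x = Y y" for x y
    using bij_betw_imp_inj_on[OF XY] that by (auto dest: injD)
  have surj: "\<exists>z. X z = u \<and> Y z = v" if "u \<in> F3_vecs m" "v \<in> F3_vecs m" for u v
  proof -
    have "(u, v) \<in> range (\<lambda>z. (X z, Y z))"
      using bij_betw_imp_surj_on[OF XY] that by simp
    then show ?thesis
      by auto
  qed
  define z0 where "z0 = (\<lambda>_ :: nat. 0 :: 'a)"
  have z0: "z0 \<in> F3_vecs m"
    by (simp add: z0_def F3_vecs_def F3_zero[OF three])
  have tr: "Tr n x \<in> F3" for x :: 'a
    by (rule Tr_in_F3[OF three]) (simp add: card[symmetric] power_card_eq_self)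
  have piin: "\<pi> v \<in> F3_vecs m" if "v \<in> F3_vecs m" for v
    using bij_betwE[OF pi] that by auto
  have f_in: "f z \<in> F3" for z
    unfolding f by (rule F3_add[OF three dot_in_F3[OF three Xin piin[OF Yin]] funcset_mem[OF g Yin]])
  define s where "s z = omega_pow (f z - Tr n (b * z))" for z
  define chi where "chi v d = dot m (X d) (\<pi> v) - Tr n (b * d)" for v d
  have chi_in: "chi v d \<in> F3" if "v \<in> F3_vecs m" for v d
    unfolding chi_def by (intro F3_diff[OF three] dot_in_F3[OF three] Xin piin that tr)
  have Yd: "Y (z + d) = Y z" if "Y d = z0" for z d
    using that by (auto simp: z0_def Yadd fun_eq_iff)
  have shift: "s (z + d) = s z * omega_pow (chi (Y z) d)" if "Y d = z0" for z d
  proof -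
    have "dot m (X (z + d)) (\<pi> (Y z)) = dot m (X z) (\<pi> (Y z)) + dot m (X d) (\<pi> (Y z))"
      by (simp add: dot_def Xadd distrib_right sum.distrib)
    then have "f (z + d) - Tr n (b * (z + d)) = (f z - Tr n (b * z)) + chi (Y z) d"
      by (simp add: f Yd[OF that] chi_def distrib_left Tr_add[OF three])
    then show ?thesis
      unfolding s_def
      using omega_pow_add[OF three F3_diff[OF three f_in tr] chi_in[OF Yin]] by simp
  qed
  have fibre0: "(\<Sum>z | Y z = v. s z) = 0" if v: "v \<in> F3_vecs m" and d: "Y d = z0" "chi v d \<noteq> 0" for v d
  proof -
    have "(\<Sum>z | Y z = v. s z) = (\<Sum>z | Y z = v. s (z + d))"
    proof (rule sum.reindex_bij_witness[of _ "\<lambda>z. z + d" "\<lambda>z. z - d"])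
      show "z - d \<in> {z. Y z = v}" if "z \<in> {z. Y z = v}" for z
        using that Yd[OF d(1), of "z - d"] by simp
    qed (auto simp: Yd[OF d(1)])
    also have "\<dots> = (\<Sum>z | Y z = v. s z) * omega_pow (chi v d)"
      by (simp add: sum_distrib_right shift[OF d(1)])
    finally show ?thesis
      using omega_pow_neq_1[OF three chi_in[OF v] d(2)] by simp
  qed
  have fibre1: "(\<Sum>z | Y z = Y w. s z) = 3 ^ m * s w" if chi: "\<And>d. Y d = z0 \<Longrightarrow> chi (Y w) d = 0" for w
  proof -
    have eq: "s z = s w" if "Y z = Y w" for z
    proof -
      have "Y (z - w) = z0"
        using that by (auto simp: z0_def Ydiff)
      then show ?thesis
        using shift[of "z - w" w] chi by (simp add: omega_pow_simps[OF three])
    qed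
    have "inj_on X {z. Y z = Y w}"
      by (rule inj_onI) (auto intro: inj)
    moreover have "X ` {z. Y z = Y w} = F3_vecs m"
      using surj[OF _ Yin[of w]] Xin by blast
    ultimately have "bij_betw X {z. Y z = Y w} (F3_vecs m)"
      by (simp add: bij_betw_def)
    then have "card {z. Y z = Y w} = 3 ^ m"
      by (simp add: bij_betw_same_card card_F3_vecs[OF three])
    moreover have "(\<Sum>z | Y z = Y w. s z) = (\<Sum>z | Y z = Y w. s w)"
      by (rule sum.cong) (auto dest: eq)
    ultimately show ?thesis
      by simp
  qed
  define unit where "unit i = (\<lambda>j. if j = i then 1 else 0 :: 'a)" for i :: nat
  have unit: "unit i \<in> F3_vecs m" if "i < m" for i
    using that by (auto simp: F3_vecs_def unit_def F3_zero[OF three] F3_one[OF three])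
  have "\<exists>d. i < m \<longrightarrow> X d = unit i \<and> Y d = z0" for i
    using surj[OF unit z0] by blast
  then obtain d where d: "\<And>i. i < m \<Longrightarrow> X (d i) = unit i" "\<And>i. i < m \<Longrightarrow> Y (d i) = z0"
    by metis
  \<comment> \<open>\<open>c\<close> represents the functional \<open>Tr n (b * _)\<close> on the
    kernel of \<open>Y\<close> with respect to the \<open>d i\<close>, with zeros from
    \<open>m\<close> on as \<open>F3_vecs\<close> demands. The contributing fibre lies over the
    preimage of \<open>c\<close> under \<open>\<pi>\<close>.\<close>
  define c where "c i = (if i < m then Tr n (b * d i) else 0)" for i
  have "c \<in> F3_vecs m"
    by (simp add: F3_vecs_def c_def tr)
  then obtain v where v: "v \<in> F3_vecs m" "\<pi> v = c"
    using bij_betw_imp_surj_on[OF pi] by (metis imageE)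
  obtain w where w: "Y w = v"
    using surj[OF z0 v(1)] by blast
  \<comment> \<open>An element \<open>x\<close> of the kernel of \<open>Y\<close> is the combination
    of the \<open>d i\<close> with coefficients \<open>X x\<close>, so agreement on the
    \<open>d i\<close> suffices.\<close>
  have "chi v x = 0" if x: "Y x = z0" for x
  proof -
    have Xx: "X x i \<in> F3" if "i < m" for i
      using Xin[of x] that by (auto simp: F3_vecs_def)
    have lin: "F3_linear (\<lambda>z. X z j)" "F3_linear (\<lambda>z. Y z j)" for j
      using iso unfolding lin_iso_def by auto
    have "X (dot m (X x) d) j = dot m (X x) (\<lambda>i. unit i j)" for j
      using F3_linear_dot[OF lin(1)[of j] Xx, where e = d] d(1) by (simp add: dot_def)
    moreover have "dot m (X x) (\<lambda>i. unit i j) = X x j" for j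
      using Xin[of x] by (simp add: dot_def unit_def F3_vecs_def if_distrib[of "\<lambda>x. _ * x"] cong: if_cong)
    moreover have "Y (dot m (X x) d) j = 0" for j
      using F3_linear_dot[OF lin(2)[of j] Xx, where e = d] d(2) by (simp add: dot_def z0_def)
    ultimately have "dot m (X x) d = x"
      using x by (intro inj) (auto simp: z0_def fun_eq_iff)
    moreover have "F3_linear (\<lambda>z. Tr n (b * z))"
      by (rule F3_linearI[OF three]) (simp add: distrib_left Tr_add[OF three])
    from F3_linear_dot[OF this Xx, where e = d]
    have "Tr n (b * dot m (X x) d) = dot m (X x) (\<lambda>i. Tr n (b * d i))" .
    ultimately have "Tr n (b * x) = dot m (X x) (\<lambda>i. Tr n (b * d i))"
      by simp
    then show ?thesis
      by (simp add: chi_def v(2) c_def dot_def)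
  qed
  then have main: "(\<Sum>z | Y z = v. s z) = 3 ^ m * s w"
    using fibre1[of w] w by simp
  have other: "(\<Sum>z | Y z = v'. s z) = 0" if v': "v' \<in> F3_vecs m" "v' \<noteq> v" for v'
  proof -
    have "\<pi> v' \<noteq> c"
      using bij_betw_imp_inj_on[OF pi] v v' by (auto dest: inj_onD)
    \<comment> \<open>A coordinate in which \<open>\<pi> v'\<close> and \<open>c\<close> differ
      yields a translation \<open>d i\<close> whose character value is not trivial.\<close>
    then obtain i where i: "\<pi> v' i \<noteq> c i"
      by auto
    with piin[OF v'(1)] have "i < m"
      by (cases "i < m") (auto simp: F3_vecs_def c_def)
    then have "chi v' (d i) = \<pi> v' i - c i"
      by (simp add: chi_def d unit_def dot_unit c_def)
    then show ?thesis
      using fibre0[OF v'(1) d(2)[OF \<open>i < m\<close>]] i by simp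
  qed
  have "walsh n f b = (\<Sum>z\<in>UNIV. s z)"
    by (simp add: walsh_def s_def)
  also have "\<dots> = (\<Sum>v'\<in>F3_vecs m. \<Sum>z | Y z = v'. s z)"
    using sum.group[of UNIV "F3_vecs m" Y s] Yin by (simp add: finite_F3_vecs[OF three] image_subset_iff)
  also have "\<dots> = (\<Sum>z | Y z = v. s z)"
    using v(1) other by (subst sum.remove[OF finite_F3_vecs[OF three] v(1)]) simp
  finally show ?thesis
    using main s_def by auto
qed

text \<open>Every Walsh value is \<open>3 ^ m\<close> times a cube root of unity, which gives
  bentness and regularity at once. The dual function at \<open>b\<close> is the phase at the point
  supplied by \<open>MM_class_walsh\<close>.\<close>

lemma MM_class_regular_bent:
  assumes card: "CARD('a) = 3 ^ n" and f: "f \<in> MM_class n"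
  shows "regular_bent n (f :: 'a \<Rightarrow> 'a)"
proof -
  obtain m X Y \<pi> g where mm: "n = 2 * m" "lin_iso m X Y" "bij_betw \<pi> (F3_vecs m) (F3_vecs m)"
      "g \<in> F3_vecs m \<rightarrow> F3" "\<And>z. f z = dot m (X z) (\<pi> (Y z)) + g (Y z)"
    using f unfolding MM_class_def by auto
  have XY: "X z \<in> F3_vecs m" "Y z \<in> F3_vecs m" for z
    using mm(2) by (auto simp: lin_iso_def dest!: bij_betwE)
  have f_in: "f z \<in> F3" for z
    using mm(4) XY bij_betwE[OF mm(3)]
    by (auto simp: mm(5) intro!: F3_add[OF three] dot_in_F3[OF three])
  have tr: "Tr n x \<in> F3" for x :: 'a
    by (rule Tr_in_F3[OF three]) (simp add: card[symmetric] power_card_eq_self)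
  obtain z where z: "\<And>b. walsh n f b = 3 ^ m * omega_pow (f (z b) - Tr n (b * z b))"
    using MM_class_walsh[OF card mm] by metis
  show ?thesis
    unfolding regular_bent_def bent_def
  proof (intro conjI allI exI)
    show "(cmod (walsh n f b))\<^sup>2 = 3 ^ n" for b
      unfolding z norm_mult norm_power norm_omega_pow
      by (simp add: mm(1) power_mult[symmetric] mult.commute)
    show "(\<lambda>b. f (z b) - Tr n (b * z b)) \<in> UNIV \<rightarrow> F3"
      using F3_diff[OF three] f_in tr by auto
    show "complex_of_real (3 powr (- real n / 2)) * walsh n f b = omega_pow (f (z b) - Tr n (b * z b))" for b
      unfolding mm(1) powr_neg_half z[unfolded mm(1)] by simp
  qed (use f_in in auto)
qed

text \<open>A criterion free of coordinates: \<open>P\<close> is an additive projection whose range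
  and kernel have equal size, and \<open>f\<close> is affine along the range. Nondegeneracy says
  that distinct kernel elements induce distinct functionals on the range, so \<open>\<pi>\<close> is
  injective on a finite set and hence a permutation.\<close>

lemma MM_classI:
  fixes P :: "'a \<Rightarrow> 'a"
  assumes card: "CARD('a) = 3 ^ n" "n = 2 * m"
    and P: "\<And>x y. P (x + y) = P x + P y" "\<And>x. P (P x) = P x" "card (range P) = 3 ^ m"
    and f: "\<And>z. f z = B (P z) (z - P z) + g (z - P z)"
    and B_add: "\<And>u u' w. B (u + u') w = B u w + B u' w"
    and F3: "\<And>u w. B u w \<in> F3" "\<And>w. g w \<in> F3"
    and nondeg: "\<And>w w'. P w = 0 \<Longrightarrow> P w' = 0 \<Longrightarrow> w \<noteq> w' \<Longrightarrow> \<exists>u\<in>range P. B u w \<noteq> B u w'"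
  shows "f \<in> MM_class n"
proof -
  have P0: "P 0 = 0"
    using P(1)[of 0 0] by (metis add_0 add_cancel_right_right)
  have Pdiff: "P (x - y) = P x - P y" for x y
    using P(1)[of "x - y" y] by (simp add: algebra_simps)
  define W where "W = {w. P w = 0}"
  have inW: "z - P z \<in> W" for z
    using Pdiff[of z "P z"] P(2)[of z] by (simp add: W_def)
  have "bij_betw (\<lambda>z. (P z, z - P z)) UNIV (range P \<times> W)"
    by (rule bij_betw_byWitness[of _ "\<lambda>(u, w). u + w"]) (auto simp: P Pdiff W_def)
  then have "CARD('a) = card (range P) * card W"
    by (simp add: bij_betw_same_card card_cartesian_product)
  then have "card W = 3 ^ m"
    using card P(3) by (simp add: mult_2 power_add)
  then obtain e' where e': "\<And>i. i < m \<Longrightarrow> e' i \<in> W" "bij_betw (\<lambda>c. dot m c e') (F3_vecs m) W"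
    using subgroup_basis[OF three, of W m] by (auto simp: W_def P P0)
  have rangeP_add: "x + y \<in> range P" if "x \<in> range P" "y \<in> range P" for x y
    using that by (auto simp: P(1)[symmetric])
  have "0 \<in> range P"
    by (metis P0 rangeI)
  then obtain e where e: "\<And>i. i < m \<Longrightarrow> e i \<in> range P" "bij_betw (\<lambda>c. dot m c e) (F3_vecs m) (range P)"
    using subgroup_basis[OF three _ rangeP_add P(3)] by blast
  have dot_add: "dot m (\<lambda>i. c i + d i) h = dot m c h + dot m d h" for c d h :: "nat \<Rightarrow> 'a"
    by (simp add: dot_def distrib_right sum.distrib)
  \<comment> \<open>An additive map into a subgroup with a basis has linear coordinate
    functions.\<close>
  have coords: "\<exists>C. (\<forall>z. C z \<in> F3_vecs m \<and> dot m (C z) b = h z) \<and> (\<forall>i. F3_linear (\<lambda>z. C z i))"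
    if b: "bij_betw (\<lambda>c. dot m c b) (F3_vecs m) V" and h: "\<And>z. h z \<in> V" "\<And>x y. h (x + y) = h x + h y"
    for b V and h :: "'a \<Rightarrow> 'a"
  proof -
    have "\<forall>z. \<exists>c. c \<in> F3_vecs m \<and> dot m c b = h z"
      using h(1) bij_betw_imp_surj_on[OF b] by (metis imageE)
    then obtain C where C: "\<And>z. C z \<in> F3_vecs m" "\<And>z. dot m (C z) b = h z"
      by metis
    have "C (x + y) = (\<lambda>i. C x i + C y i)" for x y
      by (rule inj_onD[OF bij_betw_imp_inj_on[OF b]])
         (auto simp: C dot_add h(2) intro!: F3_vecs_add[OF three])
    then have "F3_linear (\<lambda>z. C z i)" for i
      by (intro F3_linearI[OF three]) simp
    with C show ?thesis
      by blast
  qed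
  obtain X where X: "\<And>z. X z \<in> F3_vecs m" "\<And>z. dot m (X z) e = P z" "\<And>i. F3_linear (\<lambda>z. X z i)"
    using coords[OF e(2), of P] P(1) by blast
  obtain Y where Y: "\<And>z. Y z \<in> F3_vecs m" "\<And>z. dot m (Y z) e' = z - P z" "\<And>i. F3_linear (\<lambda>z. Y z i)"
  proof -
    have "x + y - P (x + y) = (x - P x) + (y - P y)" for x y
      by (simp add: P(1))
    then show ?thesis
      using coords[OF e'(2), of "\<lambda>z. z - P z"] inW that by blast
  qed
  have iso: "lin_iso m X Y"
    unfolding lin_iso_def
  proof (intro conjI allI)
    have "inj (\<lambda>z. (X z, Y z))"
      by (rule injI) (metis X(2) Y(2) diff_add_cancel prod.inject)
    moreover have "range (\<lambda>z. (X z, Y z)) = F3_vecs m \<times> F3_vecs m"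
      using X Y card calculation
      by (intro card_subset_eq)
         (auto simp: finite_F3_vecs[OF three] card_image card_cartesian_product card_F3_vecs[OF three]
            mult_2 power_add)
    ultimately show "bij_betw (\<lambda>z. (X z, Y z)) UNIV (F3_vecs m \<times> F3_vecs m)"
      by (simp add: bij_betw_def)
  qed (use X Y in auto)
  \<comment> \<open>\<open>\<pi> v\<close> is the vector of the functional
    \<open>B _ (dot m v e')\<close> in the basis \<open>e\<close> of the range of
    \<open>P\<close>.\<close>
  define \<pi> where "\<pi> v = (\<lambda>i. if i < m then B (e i) (dot m v e') else 0)" for v
  have B_dot: "B (dot m c e) w = dot m c (\<lambda>i. B (e i) w)" if "c \<in> F3_vecs m" for c w
    by (rule F3_linear_dot[OF F3_linearI[OF three]]) (use that B_add in \<open>auto simp: F3_vecs_def\<close>)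
  have dot_pi: "dot m c (\<pi> v) = B (dot m c e) (dot m v e')" if "c \<in> F3_vecs m" for c v
    by (simp add: B_dot[OF that]) (simp add: dot_def \<pi>_def)
  have "inj_on \<pi> (F3_vecs m)"
  proof (rule inj_onI, rule ccontr)
    fix v v' :: "nat \<Rightarrow> 'a"
    assume v: "v \<in> F3_vecs m" "v' \<in> F3_vecs m" "\<pi> v = \<pi> v'" "v \<noteq> v'"
    then have "dot m v e' \<noteq> dot m v' e'"
      using bij_betw_imp_inj_on[OF e'(2)] by (auto dest: inj_onD)
    moreover have "P (dot m v e') = 0" "P (dot m v' e') = 0"
      using v bij_betwE[OF e'(2)] by (auto simp: W_def)
    ultimately obtain u where u: "u \<in> range P" "B u (dot m v e') \<noteq> B u (dot m v' e')"
      using nondeg by blast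
    then obtain c where "c \<in> F3_vecs m" "u = dot m c e"
      using bij_betw_imp_surj_on[OF e(2)] by (metis imageE)
    with u v(3) show False
      by (metis dot_pi)
  qed
  moreover have "\<pi> ` F3_vecs m \<subseteq> F3_vecs m"
    by (auto simp: \<pi>_def F3_vecs_def F3)
  ultimately have "bij_betw \<pi> (F3_vecs m) (F3_vecs m)"
    by (simp add: bij_betw_def endo_inj_surj finite_F3_vecs[OF three])
  moreover have "f z = dot m (X z) (\<pi> (Y z)) + g (dot m (Y z) e')" for z
    by (simp add: dot_pi X Y f)
  moreover have "(\<lambda>v. g (dot m v e')) \<in> F3_vecs m \<rightarrow> F3"
    by (simp add: F3)
  ultimately show ?thesis
    unfolding MM_class_def mem_Collect_eq using card(2) iso
    by (intro exI[of _ m] exI[of _ X] exI[of _ Y] exI[of _ \<pi>] exI[of _ "\<lambda>v. g (dot m v e')"]) simp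
qed

end

section \<open>The quartic form\<close>

locale quartic =
  fixes a :: "'a::{field,finite}" and n k :: nat
  assumes card: "CARD('a) = 3 ^ n" and n_eq: "n = 4 * k" and k_mod: "k mod 4 = 3"
    and root: "a ^ 4 + a - 1 = 0"
begin

lemma three: "(3 :: 'a) = 0"
  using card by (rule three_eq_zero)

section \<open>Powers of \<open>a\<close>, conjugation and the fixed field\<close>

lemma a4: "a ^ 4 = 1 - a"
  using root by (simp add: algebra_simps)

lemma a_nonzero: "a \<noteq> 0"
  using root by auto

lemma inverse_a: "inverse a = a ^ 3 + 1"
proof -
  have "a * (a ^ 3 + 1) = a ^ 4 + a"
    by algebra
  then have "a * (a ^ 3 + 1) = 1"
    by (simp add: a4)
  then show ?thesis
    by (rule inverse_unique)
qed

lemma a9: "a ^ 9 = a + a\<^sup>2 + a ^ 3"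
proof -
  have "a ^ 9 = a * (a ^ 4)\<^sup>2"
    by algebra
  also have "\<dots> = a + a\<^sup>2 + a ^ 3 - 3 * a\<^sup>2"
    unfolding a4 by algebra
  finally show ?thesis
    unfolding three by simp
qed

lemma a27: "a ^ 27 = a - a\<^sup>2 + a ^ 3"
proof -
  have "a ^ 27 = (a ^ 9) ^ 3 ^ 1"
    by (simp add: power_mult[symmetric])
  also have "\<dots> = a ^ 3 + a\<^sup>2 * a ^ 4 + a ^ 9"
    unfolding a9 frob_add[OF three] by (simp add: power_mult[symmetric] power_add[symmetric] a9)
  also have "\<dots> = a - a\<^sup>2 + a ^ 3 + 3 * a\<^sup>2"
    unfolding a9 a4 by algebra
  finally show ?thesis
    unfolding three by simp
qed

lemma a81: "a ^ 81 = a"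
proof -
  have "a ^ 81 = (a ^ 27) ^ 3 ^ 1"
    by (simp add: power_mult[symmetric])
  also have "\<dots> = a ^ 3 - a\<^sup>2 * a ^ 4 + a ^ 9"
    unfolding a27 frob_add[OF three] frob_diff[OF three] by (simp add: power_mult[symmetric] power_add[symmetric])
  also have "\<dots> = a + 3 * a ^ 3"
    unfolding a9 a4 by algebra
  finally show ?thesis
    unfolding three by simp
qed

text \<open>The Frobenius map relative to \<open>L\<close>; its fourth power is the identity because
  \<open>n = 4 * k\<close>.\<close>

definition sg :: "'a \<Rightarrow> 'a" where "sg x = x ^ 3 ^ k"

lemma sg_add: "sg (x + y) = sg x + sg y"
  and sg_diff: "sg (x - y) = sg x - sg y"
  and sg_minus: "sg (- x) = - sg x"
  and sg_mult: "sg (x * y) = sg x * sg y"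
  and sg_power: "sg (x ^ j) = sg x ^ j"
  and sg_1: "sg 1 = 1"
  and sg_0: "sg 0 = 0"
  by (simp_all add: sg_def frob_add[OF three] frob_diff[OF three] frob_minus power_mult_distrib
      power_mult[symmetric] mult.commute)

lemmas sg_simps = sg_add sg_diff sg_minus sg_mult sg_power sg_1 sg_0

lemma sg_4: "sg (sg (sg (sg x))) = x"
proof -
  have "n = k + k + k + k"
    using n_eq by simp
  then have "sg (sg (sg (sg x))) = x ^ 3 ^ n"
    by (simp add: sg_def power_mult[symmetric] power_add[symmetric])
  then show ?thesis
    by (simp add: card[symmetric] power_card_eq_self)
qed

text \<open>Since \<open>a ^ 81 = a\<close>, only \<open>k mod 4\<close> matters, and the residue 3
  gives \<open>sg a = a ^ 27\<close>.\<close>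

lemma sg_a: "sg a = a - a\<^sup>2 + a ^ 3"
proof -
  have pow81: "a ^ 81 ^ j = a" for j
    by (induction j) (simp_all add: power_mult a81)
  have "k = 4 * (k div 4) + 3"
    using k_mod by presburger
  then have "(3 :: nat) ^ k = (3 ^ 4) ^ (k div 4) * 3 ^ 3"
    by (metis power_add power_mult)
  then show ?thesis
    by (simp add: sg_def power_mult pow81 a27)
qed

lemma sg_sg_a: "sg (sg a) = a + a\<^sup>2 + a ^ 3"
proof -
  have "sg (sg a) = (a ^ 27) ^ 27"
    unfolding sg_a a27[symmetric] sg_power ..
  also have "\<dots> = (a ^ 81) ^ 9"
    by (simp add: power_mult[symmetric])
  finally show ?thesis
    by (simp add: a81 a9)
qed

lemma sg_sg_sg_a: "sg (sg (sg a)) = a ^ 3"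
proof -
  have "sg (sg (sg a)) = (a ^ 27) ^ 9"
    unfolding sg_sg_a a9[symmetric] unfolding sg_power sg_a a27[symmetric] ..
  also have "\<dots> = (a ^ 81) ^ 3"
    by (simp add: power_mult[symmetric])
  finally show ?thesis
    by (simp add: a81)
qed

text \<open>The fixed field of \<open>sg\<close>; \<open>card_L\<close> shows that it has
  \<open>3 ^ k\<close> elements.\<close>

definition L :: "'a set" where "L = {x. sg x = x}"

lemma L_closed:
  "x \<in> L \<Longrightarrow> y \<in> L \<Longrightarrow> x + y \<in> L" "x \<in> L \<Longrightarrow> y \<in> L \<Longrightarrow> x - y \<in> L"
  "x \<in> L \<Longrightarrow> y \<in> L \<Longrightarrow> x * y \<in> L" "x \<in> L \<Longrightarrow> - x \<in> L" "x \<in> L \<Longrightarrow> x ^ j \<in> L" "1 \<in> L" "0 \<in> L"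
  by (simp_all add: L_def sg_simps)

lemma L_two: "2 \<in> L"
  using L_closed(1)[OF L_closed(6) L_closed(6)] by simp

lemma L_divide: "x \<in> L \<Longrightarrow> y \<in> L \<Longrightarrow> x / y \<in> L"
  by (simp add: L_def sg_def power_divide)

text \<open>Since \<open>k\<close> is odd, \<open>-1\<close> is not a square in the field with \<open>3 ^ k\<close> elements.\<close>

lemma L_anisotropic:
  assumes s: "s \<in> L" and t: "t \<in> L" and sum: "s\<^sup>2 + t\<^sup>2 = 0"
  shows "s = 0 \<and> t = 0"
proof (rule ccontr)
  assume "\<not> (s = 0 \<and> t = 0)"
  with sum have nz: "s \<noteq> 0" "t \<noteq> 0"
    by auto
  define i where "i = s / t"
  have "i \<in> L"
    unfolding i_def by (intro L_divide s t)
  have "i\<^sup>2 = - 1"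
    using sum nz by (simp add: i_def power_divide field_simps eq_neg_iff_add_eq_0)
  obtain j where "k = 2 * j + 1"
    using k_mod by (intro that[of "k div 2"]) presburger
  then have "(3 :: nat) ^ k = 3 * 9 ^ j"
    by (simp add: power_mult)
  moreover have "(9 :: nat) ^ j mod 4 = 1"
    using power_mod[of "9 :: nat" 4 j] by simp
  ultimately have "(3 :: nat) ^ k mod 4 = 3"
    by presburger
  \<comment> \<open>As \<open>3 ^ k\<close> is 3 modulo 4, \<open>sg i\<close> is an odd power of
    \<open>i\<^sup>2 = - 1\<close> times \<open>i\<close>, that is \<open>- i\<close>, whereas
    \<open>sg\<close> fixes \<open>i\<close>.\<close>
  then have "3 ^ k = 2 * (2 * (3 ^ k div 4) + 1) + (1 :: nat)"
    by presburger
  then have "sg i = (i\<^sup>2) ^ (2 * (3 ^ k div 4) + 1) * i"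
    unfolding sg_def by (metis power_add power_mult power_one_right)
  also have "\<dots> = - i"
    unfolding \<open>i\<^sup>2 = - 1\<close> by simp
  finally have "2 * i = 0"
    using \<open>i \<in> L\<close> by (simp add: L_def)
  then show False
    using two_neq_zero[OF three] nz by (simp add: i_def)
qed

section \<open>The relative trace to \<open>L\<close> and the dual basis\<close>

definition T :: "'a \<Rightarrow> 'a" where "T x = x + sg x + sg (sg x) + sg (sg (sg x))"

lemma T_add: "T (x + y) = T x + T y"
  by (simp add: T_def sg_simps)

lemma T_L: "T x \<in> L"
  by (simp add: L_def T_def sg_simps sg_4)

lemma T_scale: "x \<in> L \<Longrightarrow> T (x * y) = x * T y"
  by (simp add: T_def L_def sg_simps algebra_simps)

lemma T_diff: "T (x - y) = T x - T y"
  by (simp add: T_def sg_simps)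

text \<open>Transitivity of the trace: the \<open>n\<close> Frobenius powers split into four blocks
  of length \<open>k\<close>.\<close>

lemma Tr_n_eq: "Tr n x = Tr k (T x)"
proof -
  have "n = k + k + k + k"
    using n_eq by simp
  then show ?thesis
    by (simp add: Tr_plus T_def Tr_add[OF three] sg_def power_add power_mult)
qed

text \<open>The traces of \<open>a ^ j\<close> for \<open>j\<close> up to 6 make up the Gram matrix
  of the trace form on \<open>1, a, a\<^sup>2, a\<^sup>3\<close>. They are 1 for
  \<open>j = 0\<close> and \<open>j = 4\<close>, and 0 otherwise.\<close>

lemma T_one: "T 1 = 1"
proof -
  have "T 1 = 1 + 3"
    by (simp add: T_def sg_simps)
  then show ?thesis
    by (simp add: three)
qed

lemma T_a: "T a = 0"
proof -
  have "T a = 3 * (a + a ^ 3)"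
    unfolding T_def sg_sg_sg_a unfolding sg_sg_a unfolding sg_a by algebra
  then show ?thesis
    by (simp add: three)
qed

lemma T_a2: "T (a\<^sup>2) = 0"
proof -
  have "T (a\<^sup>2) = a\<^sup>2 + (a - a\<^sup>2 + a ^ 3)\<^sup>2 + (a + a\<^sup>2 + a ^ 3)\<^sup>2 + (a ^ 3)\<^sup>2"
    unfolding T_def sg_power sg_sg_sg_a unfolding sg_sg_a unfolding sg_a ..
  also have "\<dots> = 3 * a\<^sup>2 + 6 * a ^ 4 + 3 * a ^ 6 - 0 * a"
    by algebra
  also have "\<dots> = 3 * (a\<^sup>2 + 2 * a ^ 4 + a ^ 6)"
    by algebra
  finally show ?thesis
    unfolding three by simp
qed

lemma T_a3: "T (a ^ 3) = 0"
proof -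
  have "T (a ^ 3) = (T a) ^ 3 ^ 1"
    unfolding T_def frob_add[OF three] by (simp add: sg_simps)
  then show ?thesis
    by (simp add: T_a)
qed

lemma T_a4: "T (a ^ 4) = 1"
  by (simp add: a4 T_diff T_one T_a)

lemma T_a5: "T (a ^ 5) = 0"
proof -
  have "a ^ 5 = a * a ^ 4"
    by algebra
  also have "\<dots> = a - a\<^sup>2"
    unfolding a4 by algebra
  finally show ?thesis
    by (simp add: T_diff T_a T_a2)
qed

lemma T_a6: "T (a ^ 6) = 0"
proof -
  have "a ^ 6 = a\<^sup>2 * a ^ 4"
    by algebra
  also have "\<dots> = a\<^sup>2 - a ^ 3"
    unfolding a4 by algebra
  finally show ?thesis
    by (simp add: T_diff T_a2 T_a3)
qed

lemmas T_powers = T_one T_a T_a2 T_a3 T_a4 T_a5 T_a6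

text \<open>\<open>1, a\<^sup>3, a\<^sup>2, a\<close> is the basis dual to \<open>1, a, a\<^sup>2, a\<^sup>3\<close> with respect to \<open>T\<close>.\<close>

lemma T_coords:
  assumes "s0 \<in> L" "s1 \<in> L" "s2 \<in> L" "s3 \<in> L"
    and x: "x = s0 + s1 * a + s2 * a\<^sup>2 + s3 * a ^ 3"
  shows "T x = s0" "T (a ^ 3 * x) = s1" "T (a\<^sup>2 * x) = s2" "T (a * x) = s3"
proof -
  have gen: "T (y * x) = s0 * T y + s1 * T (y * a) + s2 * T (y * a\<^sup>2) + s3 * T (y * a ^ 3)" for y
    unfolding x distrib_left mult.left_commute[of y] T_add
    using assms(1-4) T_scale[OF assms(1), of y] by (simp add: T_scale mult.commute[of y s0])
  show "T x = s0"
    using gen[of 1] by (simp add: T_powers)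
  show "T (a ^ 3 * x) = s1"
    using gen[of "a ^ 3"] by (simp add: T_powers power_add[symmetric] flip: power_Suc2)
  show "T (a\<^sup>2 * x) = s2"
    using gen[of "a\<^sup>2"] by (simp add: T_powers power_add[symmetric] flip: power_Suc2)
  show "T (a * x) = s3"
    using gen[of a] by (simp add: T_powers power2_eq_square[symmetric] flip: power_Suc)
qed

text \<open>Both \<open>a\<close> and \<open>c\<close> are roots of the same quartic, and
  \<open>a - c\<close> times the left side vanishes by that equation. These sums are the
  coefficients of the conjugates of \<open>x\<close> in \<open>expand\<close>.\<close>

lemma conj_a:
  assumes "c \<in> {sg a, sg (sg a), sg (sg (sg a))}"
  shows "1 + a * c ^ 3 + a\<^sup>2 * c\<^sup>2 + a ^ 3 * c = 0"
proof -
  have c4: "c ^ 4 = 1 - c"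
    using assms by (auto simp: a4 sg_diff sg_1 simp flip: sg_power)
  have "c \<noteq> a"
  proof
    assume "c = a"
    then have "sg a = a \<or> sg (sg a) = a \<or> sg (sg (sg a)) = a"
      using assms by auto
    \<comment> \<open>Because \<open>sg\<close> has order dividing 4, fixing \<open>a\<close> after
      one or three steps implies fixing it after two. That would force \<open>a = - 1\<close>, which
      is not a root.\<close>
    then have "sg (sg a) = a"
      using sg_4[of a] by metis
    then have "a\<^sup>2 + a ^ 3 = 0"
      unfolding sg_sg_a by (simp add: add.assoc)
    moreover have "a\<^sup>2 * (a + 1) = a\<^sup>2 + a ^ 3"
      by algebra
    ultimately have "a = - 1"
      using a_nonzero by (simp add: eq_neg_iff_add_eq_0)
    then show False
      using root by simp
  qed
  have "(a - c) * (1 + a * c ^ 3 + a\<^sup>2 * c\<^sup>2 + a ^ 3 * c) = a - c + c * a ^ 4 - a * c ^ 4"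
    by algebra
  also have "\<dots> = 0"
    unfolding c4 a4 by algebra
  finally show ?thesis
    using \<open>c \<noteq> a\<close> by simp
qed

text \<open>The dual basis expansion: written out in conjugates, the coefficient of \<open>x\<close>
  is \<open>1 + 3 * a ^ 4 = 1\<close> and the other three vanish by \<open>conj_a\<close>.\<close>

lemma expand: "x = T x + T (a ^ 3 * x) * a + T (a\<^sup>2 * x) * a\<^sup>2 + T (a * x) * a ^ 3"
proof -
  define c d e where "c = sg a" and "d = sg (sg a)" and "e = sg (sg (sg a))"
  have "T x + T (a ^ 3 * x) * a + T (a\<^sup>2 * x) * a\<^sup>2 + T (a * x) * a ^ 3
    = (1 + 3 * a ^ 4) * x
      + (1 + a * c ^ 3 + a\<^sup>2 * c\<^sup>2 + a ^ 3 * c) * sg x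
      + (1 + a * d ^ 3 + a\<^sup>2 * d\<^sup>2 + a ^ 3 * d) * sg (sg x)
      + (1 + a * e ^ 3 + a\<^sup>2 * e\<^sup>2 + a ^ 3 * e) * sg (sg (sg x))"
    unfolding T_def c_def d_def e_def sg_simps by algebra
  also have "\<dots> = x"
    using conj_a[of c] conj_a[of d] conj_a[of e] by (simp add: c_def d_def e_def three)
  finally show ?thesis ..
qed

section \<open>Coordinates over \<open>L\<close> and the quartic form\<close>

lemma mult_coords:
  "(p0 + p1 * a + p2 * a\<^sup>2 + p3 * a ^ 3) * (r0 + r1 * a + r2 * a\<^sup>2 + r3 * a ^ 3) =
    (p0 * r0 + (p1 * r3 + p2 * r2 + p3 * r1)) +
    (p0 * r1 + p1 * r0 - (p1 * r3 + p2 * r2 + p3 * r1) + (p2 * r3 + p3 * r2)) * a +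
    (p0 * r2 + p1 * r1 + p2 * r0 - (p2 * r3 + p3 * r2) + p3 * r3) * a\<^sup>2 +
    (p0 * r3 + p1 * r2 + p2 * r1 + p3 * r0 - p3 * r3) * a ^ 3"
proof -
  have "(p0 + p1 * a + p2 * a\<^sup>2 + p3 * a ^ 3) * (r0 + r1 * a + r2 * a\<^sup>2 + r3 * a ^ 3) =
    p0 * r0 + (p0 * r1 + p1 * r0) * a + (p0 * r2 + p1 * r1 + p2 * r0) * a\<^sup>2 +
    (p0 * r3 + p1 * r2 + p2 * r1 + p3 * r0) * a ^ 3 +
    ((p1 * r3 + p2 * r2 + p3 * r1) + (p2 * r3 + p3 * r2) * a + p3 * r3 * a\<^sup>2) * a ^ 4"
    by algebra
  then show ?thesis
    unfolding a4 by algebra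
qed

text \<open>\<open>sg\<close> is linear over \<open>L\<close>, so it is determined by the powers of
  \<open>sg a = a ^ 27\<close>, whose cube is \<open>a\<close> again.\<close>

lemma sg_coords:
  assumes "s0 \<in> L" "s1 \<in> L" "s2 \<in> L" "s3 \<in> L"
  shows "sg (s0 + s1 * a + s2 * a\<^sup>2 + s3 * a ^ 3) =
    s0 + (s1 + s2 + s3) * a + (s2 - s1) * a\<^sup>2 + s1 * a ^ 3"
proof -
  have sg_a_cube: "sg a ^ 3 = a"
    unfolding sg_a a27[symmetric] by (simp add: power_mult[symmetric] a81)
  have "(sg a)\<^sup>2 = a\<^sup>2 - 2 * a ^ 3 + 3 * a ^ 4 - 2 * (a * a ^ 4) + a\<^sup>2 * a ^ 4"
    unfolding sg_a by algebra
  also have "\<dots> = a + a\<^sup>2 + 3 * (1 - 2 * a + a\<^sup>2 - a ^ 3)"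
    unfolding a4 by algebra
  finally have sg_a_square: "(sg a)\<^sup>2 = a + a\<^sup>2"
    unfolding three by simp
  have "sg (s0 + s1 * a + s2 * a\<^sup>2 + s3 * a ^ 3) = s0 + s1 * sg a + s2 * (sg a)\<^sup>2 + s3 * sg a ^ 3"
    using assms by (simp add: L_def sg_simps)
  also have "\<dots> = s0 + (s1 + s2 + s3) * a + (s2 - s1) * a\<^sup>2 + s1 * a ^ 3"
    unfolding sg_a_cube sg_a_square unfolding sg_a by algebra
  finally show ?thesis .
qed

text \<open>To be applied to \<open>u = z * sg z\<close>, in which both monomials of
  \<open>f\<close> are quadratic. \<open>inverse a = a ^ 3 + 1\<close> turns the second one into a
  sum of two coordinates of \<open>u * sg u\<close>. Keeping the multiple of 3 makes the final
  comparison an identity over the integers.\<close>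

lemma T_quadratic:
  assumes u: "u = u0 + u1 * a + u2 * a\<^sup>2 + u3 * a ^ 3" and L: "u0 \<in> L" "u1 \<in> L" "u2 \<in> L" "u3 \<in> L"
  shows "T (a * u\<^sup>2 + inverse a * (u * sg u)) =
    u0\<^sup>2 + 2 * u0 * u1 + u0 * u2 + u2 * u3 - u1 * u3 - u3\<^sup>2 + 3 * (u0 * u3 + u1 * u2)"
proof -
  have usq: "u * u = (u0 * u0 + (u1 * u3 + u2 * u2 + u3 * u1)) +
    (u0 * u1 + u1 * u0 - (u1 * u3 + u2 * u2 + u3 * u1) + (u2 * u3 + u3 * u2)) * a +
    (u0 * u2 + u1 * u1 + u2 * u0 - (u2 * u3 + u3 * u2) + u3 * u3) * a\<^sup>2 +
    (u0 * u3 + u1 * u2 + u2 * u1 + u3 * u0 - u3 * u3) * a ^ 3"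
    unfolding u by (rule mult_coords)
  have "T (a * u\<^sup>2) = u0 * u3 + u1 * u2 + u2 * u1 + u3 * u0 - u3 * u3"
    unfolding power2_eq_square by (rule T_coords(4)[OF _ _ _ _ usq]) (intro L_closed L)+
  moreover have usg: "u * sg u = (u0 * u0 + (u1 * u1 + u2 * (u2 - u1) + u3 * (u1 + u2 + u3))) +
    (u0 * (u1 + u2 + u3) + u1 * u0 - (u1 * u1 + u2 * (u2 - u1) + u3 * (u1 + u2 + u3)) + (u2 * u1 + u3 * (u2 - u1))) * a +
    (u0 * (u2 - u1) + u1 * (u1 + u2 + u3) + u2 * u0 - (u2 * u1 + u3 * (u2 - u1)) + u3 * u1) * a\<^sup>2 +
    (u0 * u1 + u1 * (u2 - u1) + u2 * (u1 + u2 + u3) + u3 * u0 - u3 * u1) * a ^ 3"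
    unfolding u sg_coords[OF L] by (rule mult_coords)
  moreover have "T (u * sg u) = u0 * u0 + (u1 * u1 + u2 * (u2 - u1) + u3 * (u1 + u2 + u3))"
    by (rule T_coords(1)[OF _ _ _ _ usg]) (intro L_closed L)+
  moreover have "T (a ^ 3 * (u * sg u)) =
    u0 * (u1 + u2 + u3) + u1 * u0 - (u1 * u1 + u2 * (u2 - u1) + u3 * (u1 + u2 + u3)) + (u2 * u1 + u3 * (u2 - u1))"
    by (rule T_coords(2)[OF _ _ _ _ usg]) (intro L_closed L)+
  moreover have "T (a * u\<^sup>2 + inverse a * (u * sg u)) = T (a * u\<^sup>2) + T (a ^ 3 * (u * sg u)) + T (u * sg u)"
    by (simp add: inverse_a distrib_right T_add)
  ultimately show ?thesis
    by algebra
qed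

text \<open>The plane spanned by \<open>a + a\<^sup>2\<close> and \<open>1 + a\<^sup>2\<close> was found by enumerating the planes of the field
  with 81 elements: \<open>f\<close> is affine on each translate of its \<open>L\<close>-span.\<close>

definition x1 :: "'a \<Rightarrow> 'a" where "x1 z = T (a ^ 3 * z)"
definition x2 :: "'a \<Rightarrow> 'a" where "x2 z = T z"
definition y1 :: "'a \<Rightarrow> 'a" where "y1 z = T (a * z)"
text \<open>What remains of the coefficient of \<open>a\<^sup>2\<close> after the multiples of
  \<open>a + a\<^sup>2\<close> and \<open>1 + a\<^sup>2\<close> are removed.\<close>

definition y2 :: "'a \<Rightarrow> 'a" where "y2 z = T (a\<^sup>2 * z) - x1 z - x2 z"

definition c1 :: "'a \<Rightarrow> 'a \<Rightarrow> 'a" where "c1 s t = s ^ 3 - s\<^sup>2 * t - t ^ 3"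
definition c2 :: "'a \<Rightarrow> 'a \<Rightarrow> 'a" where "c2 s t = t ^ 3 - s\<^sup>2 * t - s * t\<^sup>2"

lemma xy_L: "x1 z \<in> L" "x2 z \<in> L" "y1 z \<in> L" "y2 z \<in> L"
  unfolding x1_def x2_def y1_def y2_def by (intro L_closed T_L)+

lemma xy_add: "x1 (z + w) = x1 z + x1 w" "x2 (z + w) = x2 z + x2 w"
    "y1 (z + w) = y1 z + y1 w" "y2 (z + w) = y2 z + y2 w"
  by (simp_all add: x1_def x2_def y1_def y2_def T_add distrib_left)

lemma xy_diff: "x1 (z - w) = x1 z - x1 w" "x2 (z - w) = x2 z - x2 w"
    "y1 (z - w) = y1 z - y1 w" "y2 (z - w) = y2 z - y2 w"
  by (simp_all add: x1_def x2_def y1_def y2_def T_diff right_diff_distrib)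

lemma xy_expand: "z = x2 z + x1 z * a + (x1 z + x2 z + y2 z) * a\<^sup>2 + y1 z * a ^ 3"
  using expand[of z] by (simp add: x1_def x2_def y1_def y2_def)

lemma xy_coords:
  assumes "s0 \<in> L" "s1 \<in> L" "s2 \<in> L" "s3 \<in> L" "z = s0 + s1 * a + s2 * a\<^sup>2 + s3 * a ^ 3"
  shows "x1 z = s1" "x2 z = s0" "y1 z = s3" "y2 z = s2 - s1 - s0"
  using T_coords[OF assms] by (simp_all add: x1_def x2_def y1_def y2_def)

text \<open>In these coordinates every term of degree at least two in \<open>x1\<close> and
  \<open>x2\<close> has a coefficient divisible by 3, so the form is affine in them.\<close>

lemma quartic_form:
  "T (a * (z * sg z)\<^sup>2 + inverse a * (z * sg z * sg (z * sg z))) =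
    x1 z * c1 (y1 z) (y2 z) + x2 z * c2 (y1 z) (y2 z) + (- (y1 z ^ 4) - y2 z ^ 4)"
proof -
  define x1' x2' y1' y2' where xy: "x1' = x1 z" "x2' = x2 z" "y1' = y1 z" "y2' = y2 z"
  have L: "x1' \<in> L" "x2' \<in> L" "y1' \<in> L" "y2' \<in> L"
    unfolding xy by (fact xy_L)+
  have z: "z = x2' + x1' * a + (x1' + x2' + y2') * a\<^sup>2 + y1' * a ^ 3"
    unfolding xy by (rule xy_expand)
  have "sg z = x2' + (x1' + (x1' + x2' + y2') + y1') * a + ((x1' + x2' + y2') - x1') * a\<^sup>2 + x1' * a ^ 3"
    unfolding z by (intro sg_coords L_closed L)
  also have "x1' + (x1' + x2' + y2') + y1' = x2' + y1' + y2' - x1' + 3 * x1'"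
    by algebra
  also have "\<dots> = x2' + y1' + y2' - x1'"
    by (simp add: three)
  finally have sgz: "sg z = x2' + (x2' + y1' + y2' - x1') * a + ((x1' + x2' + y2') - x1') * a\<^sup>2 + x1' * a ^ 3" .
  \<comment> \<open>The coordinates of \<open>z * sg z\<close>, read off from
    \<open>mult_coords\<close>.\<close>
  define u0 u1 u2 u3 where u_def:
    "u0 = x1' ^ 2 + x1' * x2' - x1' * y1' + x1' * y2' + 2 * x2' ^ 2 + x2' * y1' + 2 * x2' * y2' + y1' ^ 2 + y1' * y2' + y2' ^ 2"
    "u1 = x1' * y1' + x2' * y1' - x2' * y2' - y1' ^ 2 - y2' ^ 2"
    "u2 = x1' * x2' + 2 * x1' * y1' + 2 * x2' ^ 2 - x2' * y1' + 2 * x2' * y2' - y1' * y2' - 2 * x1' ^ 2"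
    "u3 = 2 * x1' * x2' + x1' * y2' + x2' ^ 2 + 2 * x2' * y1' + 2 * x2' * y2' + y1' * y2' + y2' ^ 2 - x1' ^ 2"
  have "z * sg z = u0 + u1 * a + u2 * a\<^sup>2 + u3 * a ^ 3"
    unfolding sgz by (subst (1) z, subst mult_coords) (simp only: u_def, algebra)
  moreover have "u0 \<in> L" "u1 \<in> L" "u2 \<in> L" "u3 \<in> L"
    unfolding u_def by (intro L_closed L_two L)+
  ultimately have "T (a * (z * sg z)\<^sup>2 + inverse a * (z * sg z * sg (z * sg z))) =
    u0\<^sup>2 + 2 * u0 * u1 + u0 * u2 + u2 * u3 - u1 * u3 - u3\<^sup>2 + 3 * (u0 * u3 + u1 * u2)"
    by (rule T_quadratic)
  \<comment> \<open>The multiple of 3 turns the claim into an identity of integer polynomials.\<close>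
  also have "\<dots> = x1' * c1 y1' y2' + x2' * c2 y1' y2' + (- (y1' ^ 4) - y2' ^ 4) +
    3 * (x1' ^ 3 * x2' - x1' ^ 4 + x1' ^ 2 * x2' ^ 2 + 4 * x1' ^ 2 * x2' * y2' + x1' ^ 2 * y1' ^ 2
      + 2 * x1' ^ 2 * y2' ^ 2 + 8 * x1' * x2' ^ 3 + 5 * x1' * x2' ^ 2 * y1' + 12 * x1' * x2' ^ 2 * y2'
      + 2 * x1' * x2' * y1' ^ 2 + 4 * x1' * x2' * y1' * y2' + 7 * x1' * x2' * y2' ^ 2 - x1' * y1' ^ 3
      + x1' * y1' ^ 2 * y2' + 2 * x1' * y2' ^ 3 + 5 * x2' ^ 4 + 9 * x2' ^ 3 * y1' + 9 * x2' ^ 3 * y2'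
      - x2' ^ 2 * y1' ^ 2 + 13 * x2' ^ 2 * y1' * y2' + 6 * x2' ^ 2 * y2' ^ 2 + 4 * x2' * y1' ^ 3
      + x2' * y1' ^ 2 * y2' + 8 * x2' * y1' * y2' ^ 2 + 2 * x2' * y2' ^ 3 + 2 * y1' ^ 3 * y2'
      + y1' ^ 2 * y2' ^ 2 + 2 * y1' * y2' ^ 3 + y2' ^ 4)"
    unfolding u_def c1_def c2_def by algebra
  finally show ?thesis
    unfolding three xy by simp
qed

text \<open>If \<open>(c1, c2)\<close> agrees at \<open>(s, t)\<close> and \<open>(s', t')\<close>, then \<open>s * t' - t * s'\<close> or a sum of two
  squares vanishes, and the latter must vanish termwise because \<open>-1\<close> is not a square.\<close>

lemma cubic_nonzero:
  assumes L: "s \<in> L" "t \<in> L" and z: "c1 s t = 0" "c2 s t = 0"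
  shows "s = 0 \<and> t = 0"
proof -
  \<comment> \<open>Modulo 3, \<open>- c2 s t\<close> is \<open>t\<close> times a sum of two
    squares, so \<open>t\<close> must vanish.\<close>
  have "t * ((s - t)\<^sup>2 + t\<^sup>2) = - c2 s t + 3 * (t ^ 3 - s * t\<^sup>2)"
    unfolding c2_def by algebra
  then have "t * ((s - t)\<^sup>2 + t\<^sup>2) = 0"
    unfolding three z by simp
  then have t: "t = 0"
    using L_anisotropic[of "s - t" t] L by (auto intro: L_closed)
  with z(1) show ?thesis
    by (simp add: c1_def)
qed

lemma cubic_inj:
  assumes L: "s \<in> L" "t \<in> L" "s' \<in> L" "t' \<in> L"
    and eq: "c1 s t = c1 s' t'" "c2 s t = c2 s' t'"
  shows "s = s' \<and> t = t'"
proof (cases "s * t' = t * s'")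
  case True
  have cube: "s = s'" if "s ^ 3 = s' ^ 3" for s s' :: 'a
    using that frob_diff[OF three, of s s' 1] by simp
  show ?thesis
  proof (cases "s' = 0 \<and> t' = 0")
    case True
    then have "c1 s t = 0" "c2 s t = 0"
      using eq by (simp_all add: c1_def c2_def)
    then show ?thesis
      using cubic_nonzero[OF L(1,2)] True by simp
  next
    case False
    obtain r where r: "s = r * s'" "t = r * t'"
    proof (cases "s' = 0")
      case True
      then show ?thesis
        using False \<open>s * t' = t * s'\<close> that[of "t / t'"] by simp
    next
      case False
      then show ?thesis
        using \<open>s * t' = t * s'\<close> that[of "s / s'"] by (simp add: field_simps)
    qed
    \<comment> \<open>For proportional arguments, homogeneity of degree three leaves only
      \<open>r ^ 3 = 1\<close>, and cubing is injective in characteristic three.\<close>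
    have "c1 s t = r ^ 3 * c1 s' t'" "c2 s t = r ^ 3 * c2 s' t'"
      unfolding r c1_def c2_def by algebra+
    then have "r ^ 3 = 1"
      using eq False cubic_nonzero[OF L(3,4)] by (metis mult_cancel_right1)
    then have "r = 1"
      using cube[of r 1] by simp
    then show ?thesis
      using r by simp
  qed
next
  case False
  \<comment> \<open>In these terms the determinant of the two value pairs factors modulo 3 into
    \<open>s * t' - t * s'\<close> and a sum of two squares.\<close>
  define p e w where pew: "p = s * s'" "e = s * t' + t * s'" "w = t * t'"
  have "(s * t' - t * s') * ((p - e)\<^sup>2 + (e + w)\<^sup>2) = c2 s t * c1 s' t' - c1 s t * c2 s' t' +
    3 * (s ^ 3 * t' ^ 3 - s ^ 3 * s' * t' ^ 2 + s ^ 2 * t * s' * t' ^ 2 + s * t ^ 2 * s' ^ 3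
      - s * t ^ 2 * s' ^ 2 * t' - t ^ 3 * s' ^ 3)"
    unfolding pew c1_def c2_def by algebra
  also have "\<dots> = 0"
    unfolding three eq by simp
  finally have "(p - e)\<^sup>2 + (e + w)\<^sup>2 = 0"
    using False by simp
  then have "p - e = 0 \<and> e + w = 0"
    using L by (intro L_anisotropic) (auto simp: pew intro!: L_closed)
  then have pe: "p = e" "e = - w"
    by (auto simp: add_eq_0_iff2)
  \<comment> \<open>Now \<open>s * t'\<close> and \<open>t * s'\<close> have sum \<open>- w\<close>
    and product \<open>- w\<^sup>2\<close>. Modulo 3, their quadratic equation is again a vanishing
    sum of two squares.\<close>
  have "(s * t' - w)\<^sup>2 + w\<^sup>2 = (s * t') * e - w * p - 2 * (s * t') * w + 2 * w\<^sup>2"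
    unfolding pew by algebra
  also have "\<dots> = 3 * (w\<^sup>2 - s * t' * w)"
    unfolding pe by algebra
  also have "\<dots> = 0"
    unfolding three by simp
  finally have "s * t' - w = 0 \<and> w = 0"
    using L by (intro L_anisotropic) (auto simp: pew intro!: L_closed)
  then have "s * t' = 0" "t * s' = 0"
    using pe pew by auto
  then show ?thesis
    using False by metis
qed

section \<open>Nondegeneracy and membership in the Maiorana-McFarland class\<close>

lemma Tr_nonzero: "\<exists>x :: 'a. Tr n x \<noteq> 0"
proof (rule ccontr)
  assume "\<nexists>x :: 'a. Tr n x \<noteq> 0"
  then have zero: "Tr n x = 0" for x :: 'a
    by simp
  have "n > 0"
    using k_mod n_eq by (cases k) auto
  \<comment> \<open>The trace as a polynomial: its linear coefficient is 1 and its degree is at most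
    \<open>3 ^ (n - 1)\<close>, too small for it to vanish on the whole field.\<close>
  define p :: "'a poly" where "p = (\<Sum>i<n. monom 1 (3 ^ i))"
  have "poly p x = 0" for x
    using zero[of x] by (simp add: p_def poly_sum poly_monom Tr_def)
  moreover have "coeff p 1 = (\<Sum>i<n. if i = 0 then 1 else 0)"
    unfolding p_def coeff_sum by (intro sum.cong) auto
  then have "p \<noteq> 0"
    using \<open>n > 0\<close> by auto
  ultimately have "CARD('a) \<le> degree p"
    using card_poly_roots_bound[of p] by simp
  moreover have "degree p \<le> 3 ^ (n - 1)"
    unfolding p_def by (rule degree_sum_le) (auto simp: degree_monom_eq)
  moreover have "(3 :: nat) ^ (n - 1) < 3 ^ n"
    using \<open>n > 0\<close> by simp
  ultimately show False
    using card by simp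
qed

text \<open>The projection onto the \<open>L\<close>-span of \<open>a + a\<^sup>2\<close> and
  \<open>1 + a\<^sup>2\<close> along that of \<open>a\<^sup>3\<close> and
  \<open>a\<^sup>2\<close>.\<close>

definition P :: "'a \<Rightarrow> 'a" where "P z = x2 z + x1 z * a + (x1 z + x2 z) * a\<^sup>2"

lemma xy_P: "x1 (P z) = x1 z" "x2 (P z) = x2 z" "y1 (P z) = 0" "y2 (P z) = 0"
proof -
  have "P z = x2 z + x1 z * a + (x1 z + x2 z) * a\<^sup>2 + 0 * a ^ 3"
    by (simp add: P_def)
  from xy_coords[OF _ _ _ _ this]
  show "x1 (P z) = x1 z" "x2 (P z) = x2 z" "y1 (P z) = 0" "y2 (P z) = 0"
    by (auto intro: L_closed xy_L)
qed

lemma P_add: "P (z + w) = P z + P w"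
  by (simp add: P_def xy_add algebra_simps)

lemma P_P: "P (P z) = P z"
  by (simp add: P_def[of "P z"] xy_P) (simp add: P_def)

lemma P_eq_0: "P w = 0 \<Longrightarrow> x1 w = 0 \<and> x2 w = 0"
  using xy_P(1,2)[of w] xy_diff(1,2)[of w w] by (metis diff_self xy_diff(1,2))

lemma in_range_P:
  assumes "s \<in> L" "t \<in> L"
  shows "\<exists>u\<in>range P. x1 u = s \<and> x2 u = t"
proof -
  define z where "z = t + s * a + 0 * a\<^sup>2 + 0 * a ^ 3"
  have "x1 (P z) = s" "x2 (P z) = t"
    using xy_coords[OF _ _ _ _ z_def] assms by (auto simp: xy_P intro: L_closed)
  then show ?thesis
    by blast
qed

text \<open>The four coordinates identify the field with four copies of \<open>L\<close>, and fourth
  roots of the cardinalities are compared.\<close>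

lemma card_L: "card L = 3 ^ k"
proof -
  have "bij_betw (\<lambda>z. ((x1 z, x2 z), (y1 z, y2 z))) UNIV ((L \<times> L) \<times> (L \<times> L))"
  proof (rule bij_betw_byWitness[of _ "\<lambda>((s, t), (s', t')). t + s * a + (s + t + t') * a\<^sup>2 + s' * a ^ 3"])
    show "\<forall>z\<in>UNIV. (\<lambda>((s, t), (s', t')). t + s * a + (s + t + t') * a\<^sup>2 + s' * a ^ 3)
        ((x1 z, x2 z), (y1 z, y2 z)) = z"
      using xy_expand by auto
    show "\<forall>v\<in>(L \<times> L) \<times> (L \<times> L). (\<lambda>z. ((x1 z, x2 z), (y1 z, y2 z)))
        ((\<lambda>((s, t), (s', t')). t + s * a + (s + t + t') * a\<^sup>2 + s' * a ^ 3) v) = v"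
      by (auto simp: xy_coords[OF _ _ _ _ refl] L_closed)
  qed (auto simp: xy_L)
  from bij_betw_same_card[OF this] have "CARD('a) = card L ^ 4"
    by (simp add: card_cartesian_product power4_eq_xxxx mult.assoc)
  then have "card L ^ 4 = (3 ^ k) ^ 4"
    by (simp add: card n_eq power_mult[symmetric] mult.commute)
  then show ?thesis
    by (rule power_eq_imp_eq_base) auto
qed

lemma card_range_P: "card (range P) = 3 ^ (2 * k)"
proof -
  have "bij_betw (\<lambda>u. (x1 u, x2 u)) (range P) (L \<times> L)"
    unfolding bij_betw_def
  proof
    show "inj_on (\<lambda>u. (x1 u, x2 u)) (range P)"
    proof (rule inj_onI)
      fix u v
      assume "u \<in> range P" "v \<in> range P" and eq: "(x1 u, x2 u) = (x1 v, x2 v)"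
      then have "P u = u" "P v = v"
        by (auto simp: P_P)
      moreover have "P u = P v"
        using eq by (simp add: P_def)
      ultimately show "u = v"
        by metis
    qed
    show "(\<lambda>u. (x1 u, x2 u)) ` range P = L \<times> L"
    proof (intro equalityI subsetI)
      fix v assume "v \<in> L \<times> L"
      then obtain s t where v: "v = (s, t)" "s \<in> L" "t \<in> L"
        by blast
      then obtain u where "u \<in> range P" "x1 u = s" "x2 u = t"
        using in_range_P by blast
      then show "v \<in> (\<lambda>u. (x1 u, x2 u)) ` range P"
        using v(1) by (simp add: rev_image_eqI)
    qed (auto simp: xy_L)
  qed
  from bij_betw_same_card[OF this] have "card (range P) = 3 ^ k * 3 ^ k"
    by (simp add: card_cartesian_product card_L)
  then show ?thesis
    by (simp only: mult_2 power_add)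
qed

definition B :: "'a \<Rightarrow> 'a \<Rightarrow> 'a" where
  "B u w = Tr k (x1 u * c1 (y1 w) (y2 w) + x2 u * c2 (y1 w) (y2 w))"

text \<open>Distinct elements of the kernel of \<open>P\<close> differ in \<open>y1\<close> or
  \<open>y2\<close>, hence by \<open>cubic_inj\<close> in \<open>c1\<close> or \<open>c2\<close>.
  The coordinates of \<open>u\<close> are then chosen so that the two arguments of
  \<open>Tr k\<close> differ by a prescribed \<open>l\<close> of nonzero trace.\<close>

lemma B_nondegenerate:
  assumes "P w = 0" "P w' = 0" "w \<noteq> w'"
  shows "\<exists>u\<in>range P. B u w \<noteq> B u w'"
proof -
  obtain x :: 'a where "Tr n x \<noteq> 0"
    using Tr_nonzero by blast
  then obtain l where l: "l \<in> L" "Tr k l \<noteq> 0"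
    using Tr_n_eq T_L by metis
  define d1 where "d1 = c1 (y1 w) (y2 w) - c1 (y1 w') (y2 w')"
  define d2 where "d2 = c2 (y1 w) (y2 w) - c2 (y1 w') (y2 w')"
  have d_L: "d1 \<in> L" "d2 \<in> L"
    unfolding d1_def d2_def c1_def c2_def by (intro L_closed xy_L)+
  have "\<not> (y1 w = y1 w' \<and> y2 w = y2 w')"
    using assms P_eq_0 xy_expand[of w] xy_expand[of w'] by auto
  then have d_nz: "d1 \<noteq> 0 \<or> d2 \<noteq> 0"
    using cubic_inj[OF xy_L(3) xy_L(4) xy_L(3) xy_L(4), of w w w' w'] by (auto simp: d1_def d2_def)
  have "\<exists>s\<in>L. \<exists>t\<in>L. s * d1 + t * d2 = l"
  proof (cases "d1 = 0")
    case True
    then show ?thesis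
      using d_nz d_L l by (intro bexI[of _ 0] bexI[of _ "l / d2"]) (auto intro: L_closed L_divide)
  next
    case False
    then show ?thesis
      using d_L l by (intro bexI[of _ "l / d1"] bexI[of _ 0]) (auto intro: L_closed L_divide)
  qed
  then obtain s t where st: "s \<in> L" "t \<in> L" "s * d1 + t * d2 = l"
    by blast
  then obtain u where u: "u \<in> range P" "x1 u = s" "x2 u = t"
    using in_range_P by blast
  have "x1 u * c1 (y1 w) (y2 w) + x2 u * c2 (y1 w) (y2 w) =
      (x1 u * c1 (y1 w') (y2 w') + x2 u * c2 (y1 w') (y2 w')) + l"
    unfolding u st(3)[symmetric] d1_def d2_def by algebra
  then have "B u w = B u w' + Tr k l"
    by (simp add: B_def Tr_add[OF three])
  then show ?thesis
    using u(1) l(2) by (intro bexI[of _ u]) auto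
qed

lemma Tr_L: "x \<in> L \<Longrightarrow> Tr k x \<in> F3"
  by (rule Tr_in_F3[OF three]) (simp add: L_def sg_def)

lemma quartic_in_MM_class:
  assumes f: "\<And>x. f x = Tr n (a * x ^ (2 * (3 ^ k + 1)) + inverse a * x ^ ((3 ^ k + 1)\<^sup>2))"
  shows "f \<in> MM_class n"
proof (rule MM_classI[OF three card, of "2 * k" P f B "\<lambda>w. Tr k (- (y1 w ^ 4) - y2 w ^ 4)"])
  fix z
  have "z ^ (2 * (3 ^ k + 1)) = (z * sg z)\<^sup>2"
    by (simp add: sg_def power_mult[symmetric] power_mult_distrib mult.commute flip: power_add)
  moreover have "z ^ ((3 ^ k + 1)\<^sup>2) = z * sg z * sg (z * sg z)"
    by (simp add: sg_def power2_eq_square algebra_simps power_add power_mult power_mult_distrib)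
  ultimately have "f z = Tr k (T (a * (z * sg z)\<^sup>2 + inverse a * (z * sg z * sg (z * sg z))))"
    by (simp add: f Tr_n_eq)
  then have "f z = B z z + Tr k (- (y1 z ^ 4) - y2 z ^ 4)"
    unfolding quartic_form B_def by (simp add: Tr_add[OF three])
  \<comment> \<open>\<open>x1\<close> and \<open>x2\<close> take the same values at \<open>z\<close>
    and \<open>P z\<close>, and \<open>y1\<close> and \<open>y2\<close> the same at \<open>z\<close>
    and \<open>z - P z\<close>.\<close>
  then show "f z = B (P z) (z - P z) + Tr k (- (y1 (z - P z) ^ 4) - y2 (z - P z) ^ 4)"
    by (simp add: B_def xy_P xy_diff)
next
  show "B (u + u') w = B u w + B u' w" for u u' w
    by (simp add: B_def xy_add distrib_right Tr_add[OF three])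
  show "B u w \<in> F3" for u w
    unfolding B_def c1_def c2_def by (intro Tr_L L_closed xy_L)
  show "Tr k (- (y1 w ^ 4) - y2 w ^ 4) \<in> F3" for w
    by (intro Tr_L L_closed xy_L)
  show "\<exists>u\<in>range P. B u w \<noteq> B u w'" if "P w = 0" "P w' = 0" "w \<noteq> w'" for w w'
    using that by (rule B_nondegenerate)
qed (simp_all add: n_eq P_add P_P card_range_P)

end

section \<open>Algebraic degree\<close>

lemma digit_sum:
  assumes "\<And>i. i < N \<Longrightarrow> c i < 3"
  shows "(\<Sum>i<N. c i * 3 ^ i) < (3 :: nat) ^ N \<and>
    (\<Sum>j<N. (\<Sum>i<N. c i * 3 ^ i) div 3 ^ j mod 3) = (\<Sum>i<N. c i)"
  using assms
proof (induction N arbitrary: c)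
  case (Suc N)
  \<comment> \<open>The digits above the lowest one, moved down by one place; the induction
    hypothesis applies to them.\<close>
  define d where "d = (\<Sum>i<N. c (Suc i) * 3 ^ i)"
  have IH: "d < 3 ^ N" "(\<Sum>j<N. d div 3 ^ j mod 3) = (\<Sum>i<N. c (Suc i))"
    using Suc.IH[of "\<lambda>i. c (Suc i)"] Suc.prems by (auto simp: d_def)
  have c0: "c 0 < 3"
    using Suc.prems[of 0] by simp
  have eq: "(\<Sum>i<Suc N. c i * 3 ^ i) = c 0 + 3 * d"
    by (simp only: sum.lessThan_Suc_shift d_def sum_distrib_left) (simp add: mult_ac)
  have "(c 0 + 3 * d) div 3 ^ Suc j = d div 3 ^ j" for j
    using c0 by (simp add: div_mult2_eq)
  then have "(\<Sum>j<Suc N. (c 0 + 3 * d) div 3 ^ j mod 3) = c 0 + (\<Sum>j<N. d div 3 ^ j mod 3)"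
    using c0 by (simp only: sum.lessThan_Suc_shift) simp
  then show ?case
    unfolding eq using IH c0 by (simp only: sum.lessThan_Suc_shift) simp
qed simp

lemma ternary_weight_eq:
  assumes "d < 3 ^ N"
  shows "ternary_weight d = (\<Sum>j<N. d div 3 ^ j mod 3)"
proof -
  have zero: "d div 3 ^ j mod 3 = 0" if "d < 3 ^ j" for j
    using that by simp
  have large: "d < 3 ^ j" if "d < j" for j
  proof -
    have "j < 2 ^ j"
      by (rule less_exp)
    also have "(2 :: nat) ^ j \<le> 3 ^ j"
      by (rule power_mono) auto
    finally show ?thesis
      using that by simp
  qed
  have "d < 3 ^ j" if "N \<le> j" for j
    using power_increasing[OF that, of "3 :: nat"] assms by linarith
  \<comment> \<open>Both ranges of summation extend to a common one, since they only omit positions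
    where the digit is 0.\<close>
  then have "(\<Sum>j<N. d div 3 ^ j mod 3) = (\<Sum>j<N + Suc d. d div 3 ^ j mod 3)"
    by (intro sum.mono_neutral_left) (auto intro!: zero)
  also have "\<dots> = (\<Sum>j\<le>d. d div 3 ^ j mod 3)"
    by (intro sum.mono_neutral_right) (auto intro!: zero large)
  finally show ?thesis
    by (simp add: ternary_weight_def)
qed

lemma ternary_weight_digits:
  assumes "\<And>i. i < N \<Longrightarrow> c i < 3"
  shows "ternary_weight (\<Sum>i<N. c i * 3 ^ i) = (\<Sum>i<N. c i)"
proof -
  note digits = digit_sum[of N c, OF assms]
  show ?thesis
    using ternary_weight_eq[OF conjunct1[OF digits]] digits by simp
qed

lemma sum_delta_power:
  assumes "i < (N :: nat)"
  shows "(\<Sum>l<N. (if l = i then c else 0) * 3 ^ l) = (c * 3 ^ i :: nat)" "(\<Sum>l<N. if l = i then c else 0) = (c :: nat)"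
  using assms by (simp_all add: if_distrib[of "\<lambda>x. x * _"] cong: if_cong)

lemma ternary_weight_two:
  assumes "i < N" "j < N" "i \<noteq> j"
  shows "2 * 3 ^ i + 2 * 3 ^ j < (3 :: nat) ^ N \<and> ternary_weight (2 * 3 ^ i + 2 * 3 ^ j) = 4"
proof -
  let ?c = "\<lambda>l. (if l = i then 2 else 0) + (if l = j then 2 else 0) :: nat"
  have c: "?c l < 3" for l
    using assms(3) by auto
  show ?thesis
    using digit_sum[of N ?c, OF c] ternary_weight_digits[of N ?c, OF c]
    by (simp add: distrib_right sum.distrib sum_delta_power[OF assms(1)] sum_delta_power[OF assms(2)])
qed

lemma ternary_weight_three:
  assumes "i < N" "j < N" "l < N" "i \<noteq> j" "j \<noteq> l" "i \<noteq> l"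
  shows "3 ^ i + 2 * 3 ^ j + 3 ^ l < (3 :: nat) ^ N \<and> ternary_weight (3 ^ i + 2 * 3 ^ j + 3 ^ l) = 4"
proof -
  let ?c = "\<lambda>h. (if h = i then 1 else 0) + (if h = j then 2 else 0) + (if h = l then 1 else 0) :: nat"
  have c: "?c h < 3" for h
    using assms(4-6) by auto
  show ?thesis
    using digit_sum[of N ?c, OF c] ternary_weight_digits[of N ?c, OF c]
    by (simp add: distrib_right sum.distrib sum_delta_power[OF assms(1)] sum_delta_power[OF assms(2)]
        sum_delta_power[OF assms(3)])
qed

lemma reduced_form_eqI: "is_reduced_form f p \<Longrightarrow> reduced_form f = p"
  unfolding reduced_form_def by (rule the1_equality[OF ex1_reduced_form])

lemma algebraic_degree_eqI:
  assumes p: "is_reduced_form f p" and le: "\<And>d. coeff p d \<noteq> 0 \<Longrightarrow> ternary_weight d \<le> w"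
    and d: "coeff p d \<noteq> 0" "ternary_weight d = w"
  shows "algebraic_degree f = w"
proof -
  have "finite {d. coeff p d \<noteq> 0}"
    using MOST_coeff_eq_0[of p] by (simp add: MOST_iff_cofinite)
  then show ?thesis
    unfolding algebraic_degree_def reduced_form_eqI[OF p] using le d
    by (intro Max_eqI) auto
qed

section \<open>The exponents occurring in \<open>f\<close>\<close>

context quartic
begin

lemma k_pos: "k > 0"
  using k_mod by (cases k) auto

text \<open>\<open>x ^ 3 ^ n = x\<close>, so iterates of the Frobenius map depend only on their
  number modulo \<open>n\<close>.\<close>

lemma power_frob_mod: "x ^ 3 ^ (i mod n) = (x :: 'a) ^ 3 ^ i"
proof -
  have n_power: "x ^ 3 ^ (n * j) = x" for j and x :: 'a
    by (induction j) (simp_all add: power_add power_mult card[symmetric] power_card_eq_self)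
  have "x ^ 3 ^ i = x ^ 3 ^ (n * (i div n) + i mod n)"
    by simp
  also have "\<dots> = (x ^ 3 ^ (n * (i div n))) ^ 3 ^ (i mod n)"
    by (simp only: power_add power_mult[symmetric])
  finally show ?thesis
    unfolding n_power ..
qed

text \<open>\<open>e1 i\<close> and \<open>e2 i\<close> are \<open>3 ^ i\<close> times the two
  exponents of \<open>f\<close>, reduced modulo \<open>3 ^ n - 1\<close> by rotating the
  \<open>n\<close> ternary digits. The second pattern comes from
  \<open>(3 ^ k + 1)\<^sup>2 = 1 + 2 * 3 ^ k + 3 ^ (2 * k)\<close>.\<close>

definition e1 :: "nat \<Rightarrow> nat" where "e1 i = 2 * 3 ^ i + 2 * 3 ^ ((i + k) mod n)"
definition e2 :: "nat \<Rightarrow> nat" where "e2 i = 3 ^ i + 2 * 3 ^ ((i + k) mod n) + 3 ^ ((i + 2 * k) mod n)"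

lemma power_e1: "(x :: 'a) ^ e1 i = (x ^ (2 * (3 ^ k + 1))) ^ 3 ^ i"
proof -
  have "x ^ e1 i = (x ^ 3 ^ i)\<^sup>2 * (x ^ 3 ^ (i + k))\<^sup>2"
    unfolding e1_def power_add[of x] power_frob_mod[symmetric, of x "i + k"] by (simp add: power_mult[symmetric] mult.commute)
  also have "\<dots> = x ^ (2 * 3 ^ i + 2 * 3 ^ (i + k))"
    by (simp add: power_add power_mult[symmetric] mult.commute)
  also have "2 * 3 ^ i + 2 * 3 ^ (i + k) = 2 * (3 ^ k + 1) * (3 :: nat) ^ i"
    by (simp add: power_add algebra_simps)
  finally show ?thesis
    by (simp only: power_mult)
qed

lemma power_e2: "(x :: 'a) ^ e2 i = (x ^ ((3 ^ k + 1)\<^sup>2)) ^ 3 ^ i"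
proof -
  have "x ^ e2 i = x ^ 3 ^ i * (x ^ 3 ^ (i + k))\<^sup>2 * x ^ 3 ^ (i + 2 * k)"
    unfolding e2_def power_add[of x] power_frob_mod[symmetric, of x "i + k"]
      power_frob_mod[symmetric, of x "i + 2 * k"] by (simp add: power_mult[symmetric] mult.commute)
  also have "\<dots> = x ^ (3 ^ i + 2 * 3 ^ (i + k) + 3 ^ (i + 2 * k))"
    by (simp only: power_add[of x] power_mult[symmetric] mult.commute)
  also have "3 ^ i + 2 * 3 ^ (i + k) + 3 ^ (i + 2 * k) = (3 ^ k + 1)\<^sup>2 * (3 :: nat) ^ i"
    by (simp add: power_add power_mult power2_eq_square algebra_simps)
  finally show ?thesis
    by (simp only: power_mult)
qed

text \<open>The digit positions in \<open>e1 i\<close> and \<open>e2 i\<close> stay distinct because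
  \<open>n = 4 * k\<close>, so no carries arise.\<close>

lemma shift_mod: "i < n \<Longrightarrow> (i + c * k) mod n \<noteq> (i + d * k) mod n" if "c < d" "d < 4"
proof
  assume "(i + c * k) mod n = (i + d * k) mod n"
  then have "n dvd (i + d * k) - (i + c * k)"
    using mod_eq_dvd_iff_nat that by (metis add_le_cancel_left less_imp_le mult_le_mono1)
  then have "n dvd (d - c) * k"
    by (simp add: diff_mult_distrib)
  then have "4 dvd d - c"
    using k_pos unfolding n_eq by simp
  with that show False
    by (auto dest: dvd_imp_le)
qed

lemma weight_e1: "i < n \<Longrightarrow> e1 i < 3 ^ n \<and> ternary_weight (e1 i) = 4"
  unfolding e1_def using shift_mod[of 0 1 i] by (intro ternary_weight_two) auto

lemma weight_e2: "i < n \<Longrightarrow> e2 i < 3 ^ n \<and> ternary_weight (e2 i) = 4"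
  unfolding e2_def using shift_mod[of 0 1 i] shift_mod[of 1 2 i] shift_mod[of 0 2 i]
  by (intro ternary_weight_three) auto

text \<open>Together with \<open>three_digits_mod\<close>, this compares exponents with
  \<open>e1 0\<close> by their lowest ternary digit, which is 2 for \<open>e1 0\<close>.\<close>

lemma two_digits_mod:
  assumes "i \<noteq> 0" "j \<noteq> 0"
  shows "(2 * 3 ^ i + 2 * 3 ^ j :: nat) mod 3 \<noteq> 2"
proof -
  obtain u v :: nat where "3 ^ i = 3 * u" "3 ^ j = 3 * v"
    using assms by (metis not0_implies_Suc power_Suc)
  then show ?thesis
    by presburger
qed

lemma three_digits_mod:
  assumes "j \<noteq> 0" "i \<noteq> l"
  shows "(3 ^ i + 2 * 3 ^ j + 3 ^ l :: nat) mod 3 \<noteq> 2"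
proof -
  have digit: "\<exists>u. (3 :: nat) ^ h = 3 * u" if "h \<noteq> 0" for h
    using that by (metis not0_implies_Suc power_Suc)
  obtain v :: nat where v: "3 ^ j = 3 * v"
    using digit[OF assms(1)] by blast
  consider "i = 0" "l \<noteq> 0" | "i \<noteq> 0" "l = 0" | "i \<noteq> 0" "l \<noteq> 0"
    using assms(2) by auto
  then show ?thesis
  proof cases
    case 1
    then obtain w :: nat where "3 ^ l = 3 * w"
      using digit by blast
    with 1 v show ?thesis
      by (simp only: power_0) presburger
  next
    case 2
    then obtain u :: nat where "3 ^ i = 3 * u"
      using digit by blast
    with 2 v show ?thesis
      by (simp only: power_0) presburger
  next
    case 3
    then obtain u w :: nat where "3 ^ i = 3 * u" "3 ^ l = 3 * w"
      using digit by blast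
    with v show ?thesis
      by presburger
  qed
qed

lemma e1_0: "e1 0 = 2 + 2 * 3 ^ k" and e1_0_mod: "e1 0 mod 3 = 2"
proof -
  show e10: "e1 0 = 2 + 2 * 3 ^ k"
    unfolding e1_def using k_pos n_eq by simp
  have "(3 :: nat) ^ k = 3 * 3 ^ (k - 1)"
    using k_pos by (simp flip: power_Suc)
  then show "e1 0 mod 3 = 2"
    unfolding e10 by presburger
qed

text \<open>If \<open>i\<close> were nonzero, the lowest digit would put the second position at 0.
  Comparing the rest then gives \<open>i = k\<close>, but \<open>2 * k\<close> is not divisible by
  \<open>n\<close>.\<close>

lemma e1_eq: "i < n \<Longrightarrow> e1 i = e1 0 \<Longrightarrow> i = 0"
proof (rule ccontr)
  assume i: "i < n" "e1 i = e1 0" "i \<noteq> 0"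
  have "e1 i mod 3 = 2"
    using i(2) e1_0_mod by simp
  then have "(i + k) mod n = 0"
    using i(3) two_digits_mod unfolding e1_def by blast
  then have "(2 :: nat) * 3 ^ i + 2 = 2 + 2 * 3 ^ k"
    using i(2) unfolding e1_0 by (simp add: e1_def)
  then have "i = k"
    by simp
  then show False
    using \<open>(i + k) mod n = 0\<close> k_pos by (simp add: n_eq)
qed

text \<open>The lowest digit forces the middle position to be 0, so \<open>i = 3 * k\<close>, and
  \<open>3 ^ i\<close> alone already exceeds what remains of \<open>e1 0\<close>.\<close>

lemma e2_neq:
  assumes i: "i < n"
  shows "e2 i \<noteq> e1 0"
proof
  assume eq: "e2 i = e1 0"
  then have "e2 i mod 3 = 2"
    using e1_0_mod by simp
  moreover have "i \<noteq> (i + 2 * k) mod n"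
    using shift_mod[of 0 2 i] i by simp
  ultimately have j: "(i + k) mod n = 0"
    using three_digits_mod unfolding e2_def by blast
  then have eq: "3 ^ i + 3 ^ ((i + 2 * k) mod n) = (2 * 3 ^ k :: nat)"
    using eq unfolding e1_0 by (simp add: e2_def)
  obtain c where c: "i + k = n * c"
    using j by (metis dvd_eq_mod_eq_0 dvdE)
  have "i + k < 2 * n" "i + k > 0"
    using i k_pos by (auto simp: n_eq)
  with c have "c = 1"
    by (cases c; cases "c - 1") auto
  then have "i = k + (2 * k - 1) + 1"
    using k_pos c by (simp add: n_eq)
  then have "(3 :: nat) ^ i = 3 ^ k * 3 ^ (2 * k - 1) * 3"
    by (simp only: power_add power_one_right)
  moreover have "(3 :: nat) ^ k * 3 ^ (2 * k - 1) \<ge> 3 ^ k"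
    by simp
  moreover have "(3 :: nat) ^ k > 0"
    by simp
  ultimately have "(3 :: nat) ^ i > 2 * 3 ^ k"
    by linarith
  with eq show False
    by simp
qed

text \<open>The expanded trace has only exponents of weight four below \<open>3 ^ n\<close>, so it
  is the reduced form. The exponent \<open>e1 0\<close> arises from a single summand, so its
  coefficient \<open>a\<close> cannot cancel.\<close>

lemma quartic_degree:
  assumes f: "\<And>x. f x = Tr n (a * x ^ (2 * (3 ^ k + 1)) + inverse a * x ^ ((3 ^ k + 1)\<^sup>2))"
  shows "algebraic_degree f = 4"
proof -
  define p where "p = (\<Sum>i<n. monom (a ^ 3 ^ i) (e1 i)) + (\<Sum>i<n. monom (inverse a ^ 3 ^ i) (e2 i))"
  have coeff: "coeff p d = (\<Sum>i<n. if e1 i = d then a ^ 3 ^ i else 0) + (\<Sum>i<n. if e2 i = d then inverse a ^ 3 ^ i else 0)" for d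
    by (simp add: p_def coeff_sum)
  have supp: "\<exists>i<n. d = e1 i \<or> d = e2 i" if "coeff p d \<noteq> 0" for d
  proof (rule ccontr)
    assume "\<not> (\<exists>i<n. d = e1 i \<or> d = e2 i)"
    then have "(\<Sum>i<n. if e1 i = d then a ^ 3 ^ i else 0) = 0"
        "(\<Sum>i<n. if e2 i = d then inverse a ^ 3 ^ i else 0) = 0"
      by (auto intro!: sum.neutral)
    then have "coeff p d = 0"
      unfolding coeff by simp
    with that show False
      by simp
  qed
  show ?thesis
  proof (rule algebraic_degree_eqI)
    have "degree p < 3 ^ n"
    proof (cases "p = 0")
      case False
      then show ?thesis
        using supp[of "degree p"] weight_e1 weight_e2 by auto
    qed simp
    moreover have "poly p x = f x" for x
    proof -
      have "f x = (\<Sum>i<n. (a * x ^ (2 * (3 ^ k + 1))) ^ 3 ^ i) + (\<Sum>i<n. (inverse a * x ^ ((3 ^ k + 1)\<^sup>2)) ^ 3 ^ i)"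
        unfolding f Tr_add[OF three] unfolding Tr_def ..
      then show ?thesis
        by (simp only: p_def poly_add poly_sum poly_monom power_e1 power_e2 power_mult_distrib)
    qed
    ultimately show "is_reduced_form f p"
      by (simp add: is_reduced_form_def card)
    show "ternary_weight d \<le> 4" if "coeff p d \<noteq> 0" for d
      using supp[OF that] weight_e1 weight_e2 by auto
    have n: "0 < n"
      using k_pos n_eq by simp
    have "(\<Sum>i<n. if e1 i = e1 0 then a ^ 3 ^ i else 0) = (\<Sum>i<n. if i = 0 then a else 0)"
      using e1_eq by (intro sum.cong) auto
    moreover have "(\<Sum>i<n. if e2 i = e1 0 then inverse a ^ 3 ^ i else 0) = 0"
      using e2_neq by (intro sum.neutral) auto
    ultimately have "coeff p (e1 0) = a"
      unfolding coeff using n by simp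
    then show "coeff p (e1 0) \<noteq> 0"
      using a_nonzero by simp
    show "ternary_weight (e1 0) = 4"
      using weight_e1[OF n] by simp
  qed
qed

end

theorem theorem2:
  fixes n k :: nat and a :: "'a::{field,finite}" and K :: "'a set" and f :: "'a \<Rightarrow> 'a"
  assumes "CARD('a) = 3 ^ n"
    and "n = 4 * k" and "k mod 4 = 3"
    and "is_subfield K" and "card K = 3 ^ 4" and "a \<in> K"
    and "a ^ 4 + a - 1 = 0"
    and "\<And>x. f x = Tr n (a * x ^ (2 * (3 ^ k + 1)) + inverse a * x ^ ((3 ^ k + 1)\<^sup>2))"
  shows "regular_bent n f \<and> algebraic_degree f = 4 \<and> f \<in> completed_class (MM_class n)"
proof -
  interpret quartic a n k
    by unfold_locales (fact assms)+
  have "f \<in> MM_class n"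
    using assms(8) by (rule quartic_in_MM_class)
  moreover from this have "f \<in> completed_class (MM_class n)"
    unfolding completed_class_def by blast
  moreover have "algebraic_degree f = 4"
    using assms(8) by (rule quartic_degree)
  ultimately show ?thesis
    using MM_class_regular_bent[OF three assms(1)] by blast
qed

end
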